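(* Let $M$ be a $0/\pm1$ matrix. If $G(M)$ contains a cycle, then the profile class $\Pr(M)$ contains an infinite antichain under pattern containment. Moreover, if $G(M)$ is a cycle and $M$ has an even number of entries equal to $-1$, then there is $N$ such that the permutations whose permutation matrices are $P_n$, $n\ge N$ (from the batch construction in the context), lie in $\Pr(M)$ and form an infinite antichain.
   Context: For $p\in S_n$, $M_p$ is the $n\times n$ $0/1$ matrix with ones exactly at positions $(i,p(i))$. For permutations $q\in S_k,p\in S_n$, $q\le p$ if some subsequence $p(i_1)\dots p(i_k)$ ($i_1<\dots<i_k$) is order-isomorphic to $q$; an antichain is a set of pairwise incomparable permutations. For a matrix $P$, $P_{[a,b)\times[c,d)}$ is the (possibly empty) submatrix of rows $a,\dots,b-1$, columns $c,\dots,d-1$; a submatrix of a permutation matrix is increasing (resp. decreasing) if its nonzero entries, in order of increasing row, have strictly increasing (resp. decreasing) column indices (zero/empty submatrices are both). For an $r\times s$ matrix $M$ with entries in $\{0,1,-1\}$ and an $N\times N$ permutation matrix $P$, an $M$-partition of $P$ is a pair of multisets $I=\{1=i_1\le\dots\le i_{r+1}=N+1\}$, $J=\{1=j_1\le\dots\le j_{s+1}=N+1\}$ with $P_{[i_k,i_{k+1})\times[j_\ell,j_{\ell+1})}$ zero if $M_{k,\ell}=0$, increasing if $M_{k,\ell}=1$, decreasing if $M_{k,\ell}=-1$. $\Pr(M)$ is the set of permutations $p$ such that $M_p$ has an $M$-partition. $G(M)$ is the bipartite graph on $x_1,\dots,x_r,y_1,\dots,y_s$ with edge $x_iy_j$ iff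 $M_{i,j}\ne0$; "$G(M)$ is a cycle" means $G(M)$ is a single cycle graph. Batch construction (when $G(M)$ is a cycle, so every row and column of $M$ has exactly two nonzero entries): batches are numbered $1,2,\dots$; batch $k$ has a cell $e_k\in\mathrm{supp}(M)$ and a yearn $y_k\in\{$top-left, top-right, bottom-left, bottom-right$\}$, with yearn top-left or bottom-right if $M_{e_k}=1$ and top-right or bottom-left if $M_{e_k}=-1$. $e_1$ is the leftmost nonzero entry of row 1; $y_1$ is bottom-right if $M_{e_1}=1$, top-right if $M_{e_1}=-1$. $e_2$ is the other nonzero entry in the row of $e_1$; for $n\ge3$, $e_n$ is the nonzero cell sharing a row or column with $e_{n-1}$ distinct from $e_{n-1},e_{n-2}$. If $e_n$ shares a row with $e_{n-1}$, $y_n$ has the same vertical component (top/bottom) as $y_{n-1}$; if a column, the same horizontal component; the other component is forced by the sign of $M_{e_n}$. $\overline P_1=(1)$. $\overline P_n$ is obtained from $\overline P_{n-1}$ by inserting a new row, column and $1$ (batch $n$), where with $e_n=(i,j)$ batch $n$ is placed below all batches whose cell's row index is $<i$, above those with row index $>i$, right of those with column index $<j$, left of those with column index $>j$, and not overtaking batch $n-1$ in their shared yearn component (shared top: below batch $n-1$; shared bottom: above; shared left: to its right; shared right: to its left); subject to these, batch $n$ is placed as far as possible toward its yearn, both vertically and horizontally. $P_n$ is obtained from $\overline P_n$ by replacing batch $1$ and batch $n$ each by $\begin{pmatrix}1&0\\0&1\end{pmatrix}$ if the corresponding cell of $M$ holds $1$ and by $\begin{pmatrix}0&1\\1&0\end{pmatrix}$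 if it holds $-1$. *)

theory Defs
  imports
    "Jordan_Normal_Form.DL_Submatrix"
    "HOL-Combinatorics.Multiset_Permutations"
begin

text \<open>
  Rows, columns and permutation values are numbered from 0. A permutation is given in one-line
  notation, so that permutations of all lengths live in the type \<^typ>\<open>nat list\<close>.
\<close>

section \<open>Permutations and pattern containment\<close>

definition is_perm :: "nat list \<Rightarrow> bool" where
  "is_perm p \<longleftrightarrow> p \<in> permutations_of_set {..<length p}"

definition perm_matrix :: "nat list \<Rightarrow> int mat" where
  "perm_matrix p = mat (length p) (length p) (\<lambda>(i, j). if p ! i = j then 1 else 0)"

definition pattern_le :: "nat list \<Rightarrow> nat list \<Rightarrow> bool" where
  "pattern_le q p \<longleftrightarrow>
     (\<exists>f. strict_mono_on {..<length q} f \<and> f ` {..<length q} \<subseteq> {..<length p} \<and>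
          (\<forall>a<length q. \<forall>b<length q. q ! a < q ! b \<longleftrightarrow> p ! f a < p ! f b))"

definition antichain :: "nat list set \<Rightarrow> bool" where
  "antichain A \<longleftrightarrow> pairwise (\<lambda>p q. \<not> pattern_le p q \<and> \<not> pattern_le q p) A"

section \<open>Profile classes\<close>

definition zero_matrix :: "int mat \<Rightarrow> bool" where
  "zero_matrix A \<longleftrightarrow> A = 0\<^sub>m (dim_row A) (dim_col A)"

definition increasing_matrix :: "int mat \<Rightarrow> bool" where
  "increasing_matrix A \<longleftrightarrow>
     (\<forall>i<dim_row A. \<forall>i'<dim_row A. \<forall>j<dim_col A. \<forall>j'<dim_col A.
        A $$ (i, j) \<noteq> 0 \<and> A $$ (i', j') \<noteq> 0 \<and> i < i' \<longrightarrow> j < j')"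

definition decreasing_matrix :: "int mat \<Rightarrow> bool" where
  "decreasing_matrix A \<longleftrightarrow>
     (\<forall>i<dim_row A. \<forall>i'<dim_row A. \<forall>j<dim_col A. \<forall>j'<dim_col A.
        A $$ (i, j) \<noteq> 0 \<and> A $$ (i', j') \<noteq> 0 \<and> i < i' \<longrightarrow> j' < j)"

definition M_partition :: "int mat \<Rightarrow> int mat \<Rightarrow> nat list \<Rightarrow> nat list \<Rightarrow> bool" where
  "M_partition M P I J \<longleftrightarrow>
     length I = dim_row M + 1 \<and> sorted I \<and> hd I = 0 \<and> last I = dim_row P \<and>
     length J = dim_col M + 1 \<and> sorted J \<and> hd J = 0 \<and> last J = dim_col P \<and>
     (\<forall>k<dim_row M. \<forall>l<dim_col M.
        let B = submatrix P {I ! k..<I ! (k + 1)} {J ! l..<J ! (l + 1)} in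
          (M $$ (k, l) = 0 \<longrightarrow> zero_matrix B) \<and>
          (M $$ (k, l) = 1 \<longrightarrow> increasing_matrix B) \<and>
          (M $$ (k, l) = -1 \<longrightarrow> decreasing_matrix B))"

definition profile_class :: "int mat \<Rightarrow> nat list set" where
  "profile_class M = {p. is_perm p \<and> (\<exists>I J. M_partition M (perm_matrix p) I J)}"

section \<open>The bipartite graph of a matrix\<close>

definition supp :: "int mat \<Rightarrow> (nat \<times> nat) set" where
  "supp M = {(i, j). i < dim_row M \<and> j < dim_col M \<and> M $$ (i, j) \<noteq> 0}"

text \<open>\<^term>\<open>Inl i\<close> is the vertex of row \<open>i\<close>, \<^term>\<open>Inr j\<close> that of column \<open>j\<close>.\<close>

definition graph_verts :: "int mat \<Rightarrow> (nat + nat) set" where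
  "graph_verts M = Inl ` {..<dim_row M} \<union> Inr ` {..<dim_col M}"

definition graph_edges :: "int mat \<Rightarrow> (nat + nat) set set" where
  "graph_edges M = (\<lambda>(i, j). {Inl i, Inr j}) ` supp M"

definition cycle_graph :: "'v set \<Rightarrow> 'v set set \<Rightarrow> bool" where
  "cycle_graph V E \<longleftrightarrow>
     (\<exists>vs. 3 \<le> length vs \<and> distinct vs \<and> V = set vs \<and>
           E = {{vs ! i, vs ! (Suc i mod length vs)} | i. i < length vs})"

definition contains_cycle :: "'v set \<Rightarrow> 'v set set \<Rightarrow> bool" where
  "contains_cycle V E \<longleftrightarrow> (\<exists>V' E'. V' \<subseteq> V \<and> E' \<subseteq> E \<and> cycle_graph V' E')"

section \<open>The batch construction\<close>

text \<open>Batches are numbered from 1; the values at 0 are irrelevant.\<close>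

fun batch_cell :: "int mat \<Rightarrow> nat \<Rightarrow> nat \<times> nat" where
  "batch_cell M 0 = undefined"
| "batch_cell M (Suc 0) = (0, LEAST j. (0, j) \<in> supp M)"
| "batch_cell M (Suc (Suc 0)) =
     (THE e. e \<in> supp M \<and> fst e = fst (batch_cell M (Suc 0)) \<and> e \<noteq> batch_cell M (Suc 0))"
| "batch_cell M (Suc (Suc (Suc n))) =
     (let e' = batch_cell M (Suc (Suc n)); e'' = batch_cell M (Suc n) in
        THE e. e \<in> supp M \<and> (fst e = fst e' \<or> snd e = snd e') \<and> e \<noteq> e' \<and> e \<noteq> e'')"

datatype vdir = Top | Bottom
datatype hdir = Left | Right

text \<open>The component of a yearn forced by the other one and the sign of the cell: top-left and
  bottom-right go with 1, top-right and bottom-left with -1.\<close>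

definition forced_hdir :: "int \<Rightarrow> vdir \<Rightarrow> hdir" where
  "forced_hdir x v = (if (x = 1) = (v = Top) then Left else Right)"

definition forced_vdir :: "int \<Rightarrow> hdir \<Rightarrow> vdir" where
  "forced_vdir x h = (if (x = 1) = (h = Left) then Top else Bottom)"

fun batch_yearn :: "int mat \<Rightarrow> nat \<Rightarrow> vdir \<times> hdir" where
  "batch_yearn M 0 = undefined"
| "batch_yearn M (Suc 0) =
     (if M $$ batch_cell M (Suc 0) = 1 then (Bottom, Right) else (Top, Right))"
| "batch_yearn M (Suc (Suc n)) =
     (let e = batch_cell M (Suc (Suc n)); e' = batch_cell M (Suc n); (v, h) = batch_yearn M (Suc n) in
        if fst e = fst e' then (v, forced_hdir (M $$ e) v) else (forced_vdir (M $$ e) h, h))"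

text \<open>
  The vertical and the horizontal placement of the batches are two instances of the same
  procedure, which maintains the list of the batches in their order from top to bottom (left to
  right). Here \<open>line k\<close> is the row (column) index of the cell of batch \<open>k\<close>, and \<open>back k\<close> says
  that batch \<open>k\<close> yearns for the top (left). The admissible insertion positions of batch \<open>b\<close> are those
  respecting the lines of the cells and, if batch \<open>b\<close> shares its line with batch \<open>b - 1\<close>, those
  where it does not overtake that batch.
\<close>

definition batch_slots :: "(nat \<Rightarrow> nat) \<Rightarrow> (nat \<Rightarrow> bool) \<Rightarrow> nat list \<Rightarrow> nat \<Rightarrow> nat set" where
  "batch_slots line back xs b =
     {t. t \<le> length xs \<and>
         (\<forall>k\<in>set xs. line k < line b \<longrightarrow> k \<in> set (take t xs)) \<and>
         (\<forall>k\<in>set xs. line b < line k \<longrightarrow> k \<in> set (drop t xs)) \<and>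
         (line b = line (b - 1) \<longrightarrow>
            (if back b then b - 1 \<in> set (take t xs) else b - 1 \<in> set (drop t xs)))}"

fun batch_order :: "(nat \<Rightarrow> nat) \<Rightarrow> (nat \<Rightarrow> bool) \<Rightarrow> nat \<Rightarrow> nat list" where
  "batch_order line back 0 = []"
| "batch_order line back (Suc 0) = [1]"
| "batch_order line back (Suc (Suc n)) =
     (let b = Suc (Suc n);
          xs = batch_order line back (Suc n);
          S = batch_slots line back xs b;
          t = (if back b then Min S else Max S)
      in take t xs @ [b] @ drop t xs)"

definition row_order :: "int mat \<Rightarrow> nat \<Rightarrow> nat list" where
  "row_order M n =
     batch_order (\<lambda>k. fst (batch_cell M k)) (\<lambda>k. fst (batch_yearn M k) = Top) n"

definition col_order :: "int mat \<Rightarrow> nat \<Rightarrow> nat list" where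
  "col_order M n =
     batch_order (\<lambda>k. snd (batch_cell M k)) (\<lambda>k. snd (batch_yearn M k) = Left) n"

definition P_bar :: "int mat \<Rightarrow> nat \<Rightarrow> int mat" where
  "P_bar M n = mat n n (\<lambda>(i, j). if row_order M n ! i = col_order M n ! j then 1 else 0)"

definition batch_block :: "int mat \<Rightarrow> nat \<Rightarrow> nat \<Rightarrow> int mat" where
  "batch_block M n k =
     (if k = 1 \<or> k = n
      then if M $$ batch_cell M k = 1
           then mat_of_rows_list 2 [[1, 0], [0, 1]]
           else mat_of_rows_list 2 [[0, 1], [1, 0]]
      else 1\<^sub>m 1)"

text \<open>
  \<open>P_seq M n\<close> arises from \<open>P_bar M n\<close> by substituting the block of each batch for its entry 1.
  The pair \<open>(i, u)\<close> labels the \<open>u\<close>-th of the rows (columns) into which row (column) \<open>i\<close> of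
  \<open>P_bar M n\<close> is split.
\<close>

definition split_lines :: "int mat \<Rightarrow> nat \<Rightarrow> nat list \<Rightarrow> (nat \<times> nat) list" where
  "split_lines M n ks =
     concat (map (\<lambda>i. map (Pair i) [0..<dim_row (batch_block M n (ks ! i))]) [0..<length ks])"

definition P_seq :: "int mat \<Rightarrow> nat \<Rightarrow> int mat" where
  "P_seq M n =
     (let R = split_lines M n (row_order M n); C = split_lines M n (col_order M n) in
        mat (length R) (length C)
          (\<lambda>(x, y). let (i, u) = R ! x; (j, v) = C ! y in
             if P_bar M n $$ (i, j) = 1 then batch_block M n (row_order M n ! i) $$ (u, v) else 0))"

end

theory Submission
  imports Defs
begin

text \<open>
  Number the vertices of the cycle \<open>G(M)\<close> along the cycle, so that batch \<open>b\<close> lies in the cell given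
  by the edge joining the vertices \<open>b - 1\<close> and \<open>b\<close>. If the number of entries -1 is even, the yearns are
  periodic, and within a row or column the batches are ordered by age toward the yearn, except
  that batch \<open>b + 1\<close> lies just behind batch \<open>b\<close> in the line they share.

  Suppose \<open>P\<^sub>m\<close> embeds in \<open>P\<^sub>n\<close> with \<open>m < n\<close> and \<open>m\<close> large. By pigeonhole, over some rounds of the cycle
  the cell of the image of a batch depends only on the cell of the batch. There the embedding
  induces a closed walk on the cycle; consecutive batches interleave in the line they share, so
  the walk cannot fold back, and since it preserves the orders of the rows and of the columns it is
  the identity. Hence the embedding is there a shift \<open>b \<mapsto> b + g\<close>. This propagates in both
  directions, because batch \<open>b + 1\<close> is the only one separating the batches \<open>b\<close> and \<open>b - L\<close> in
  one direction without separating them in the other. The doubled end batches have to go to doubled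
  end batches, which forces \<open>g = 0\<close> and \<open>m = n\<close>.

  If the number of entries -1 is odd, replace 1 by the 2 by 2 identity matrix and -1 by the negative of
  the 2 by 2 exchange matrix. This turns the cycle into a cycle of twice the length with an even
  number of entries -1, without enlarging the profile class.
\<close>

section \<open>The two orders of the batches\<close>

text \<open>
  The flag \<open>e\<close> is \<^const>\<open>True\<close> for columns and \<^const>\<open>False\<close> for rows: the vertices with even number are
  columns. \<open>vtx e b\<close> is the column (row) of batch \<open>b\<close>, and \<open>rnk e b\<close> orders the batches in a line by their
  distance toward the yearn.
\<close>

definition vtx :: "bool \<Rightarrow> nat \<Rightarrow> nat" where
  "vtx e b = (if even b = e then b else b - 1)"

definition rnk :: "bool \<Rightarrow> nat \<Rightarrow> nat" where
  "rnk e b = (if even b = e then b + 1 else b - 1)"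

text \<open>The low bit ranks copy 0 of a doubled batch ahead of copy 1; the factor 2 keeps it from
  outweighing the rank.\<close>

definition key :: "bool \<Rightarrow> nat \<times> nat \<Rightarrow> nat" where
  "key e x = 2 * rnk e (fst x) + (1 - snd x)"

text \<open>
  A point is a pair of a batch and a copy number; copy 0 of a doubled batch is the one farther
  toward the yearn, both vertically and horizontally.
\<close>

definition pts :: "nat \<Rightarrow> (nat \<times> nat) set" where
  "pts n = {(b, u). 1 \<le> b \<and> b \<le> n \<and> u \<le> (if b = 1 \<or> b = n then 1 else 0)}"

lemma ptsD: "x \<in> pts n \<Longrightarrow> 1 \<le> fst x \<and> fst x \<le> n \<and> snd x \<le> 1"
  by (auto simp: pts_def split: if_splits)

lemma pts_0: "1 \<le> b \<Longrightarrow> b \<le> n \<Longrightarrow> (b, 0) \<in> pts n"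
  by (auto simp: pts_def)

lemma even_vtx: "1 \<le> b \<Longrightarrow> even (vtx e b) = e"
  by (auto simp: vtx_def)

text \<open>The values of the two branches of \<open>rnk e\<close> have opposite parities, so they
  never coincide.\<close>

lemma rnk_inj: "1 \<le> b \<Longrightarrow> 1 \<le> c \<Longrightarrow> rnk e b = rnk e c \<longleftrightarrow> b = c"
  unfolding rnk_def by (cases e; simp; presburger)

lemma key_inj:
  assumes "1 \<le> fst x" "1 \<le> fst y" "snd x \<le> 1" "snd y \<le> 1"
  shows "key e x = key e y \<longleftrightarrow> x = y"
proof -
  have "key e x = key e y \<Longrightarrow> rnk e (fst x) = rnk e (fst y) \<and> snd x = snd y"
    using assms(3,4) unfolding key_def by presburger
  then show ?thesis using rnk_inj[OF assms(1,2)] prod_eq_iff by metis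
qed

lemma key_less_imp_rnk_le: "key e x < key e y \<Longrightarrow> rnk e (fst x) \<le> rnk e (fst y)"
  unfolding key_def by linarith

lemma rnk_less_imp_key_less: "rnk e (fst x) < rnk e (fst y) \<Longrightarrow> key e x < key e y"
  unfolding key_def by linarith

lemma dvd_abs_less_imp_0: "(d::int) dvd x \<Longrightarrow> \<bar>x\<bar> < d \<Longrightarrow> x = 0"
  using dvd_imp_le_int by force

text \<open>\<open>lab k\<close> is the index of the row or column at vertex \<open>k\<close>, and \<open>w k\<close> says that it yearns for
  the top (left).\<close>

locale line_cycle =
  fixes L :: nat and lab :: "nat \<Rightarrow> nat" and w :: "nat \<Rightarrow> bool"
  assumes L_even: "even L" and L_ge: "4 \<le> L"
    and lab_eq: "even j = even k \<Longrightarrow> lab j = lab k \<longleftrightarrow> int L dvd int j - int k"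
    and w_eq: "int L dvd int j - int k \<Longrightarrow> w j = w k"
begin

section \<open>Line orders and betweenness\<close>

definition pl :: "bool \<Rightarrow> nat \<times> nat \<Rightarrow> nat" where
  "pl e x = lab (vtx e (fst x))"

text \<open>The order from top to bottom (left to right). Large keys lie toward the yearn, so a line
  yearning for the top (left) lists its points with decreasing keys.\<close>

definition pless :: "bool \<Rightarrow> nat \<times> nat \<Rightarrow> nat \<times> nat \<Rightarrow> bool" where
  "pless e x y \<longleftrightarrow> pl e x < pl e y \<or>
     pl e x = pl e y \<and> (if w (vtx e (fst x)) then key e y < key e x else key e x < key e y)"

text \<open>Inside a line, betweenness is the same for both directions of the yearn, which makes it
  comparable between rows and columns.\<close>

definition betw :: "bool \<Rightarrow> nat \<times> nat \<Rightarrow> nat \<times> nat \<Rightarrow> nat \<times> nat \<Rightarrow> bool" where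
  "betw e x y z \<longleftrightarrow> pless e x y \<and> pless e y z \<or> pless e z y \<and> pless e y x"

lemma dvd_even: "int L dvd int j - int k \<Longrightarrow> even j = even k"
proof -
  assume "int L dvd int j - int k"
  moreover have "(2::int) dvd int L" using L_even by simp
  ultimately have "(2::int) dvd int j - int k" using dvd_trans by blast
  then show ?thesis by presburger
qed

lemma pl_eq:
  assumes "1 \<le> fst x" "1 \<le> fst y"
  shows "pl e x = pl e y \<longleftrightarrow> int L dvd int (vtx e (fst x)) - int (vtx e (fst y))"
  unfolding pl_def using lab_eq even_vtx assms by metis

lemma w_pl:
  assumes "1 \<le> fst x" "1 \<le> fst y" "pl e x = pl e y"
  shows "w (vtx e (fst x)) = w (vtx e (fst y))"
  using w_eq pl_eq assms by blast

lemma pless_irrefl: "\<not> pless e x x"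
  by (auto simp: pless_def)

lemma pless_trans:
  assumes "1 \<le> fst x" "1 \<le> fst y" "1 \<le> fst z" "pless e x y" "pless e y z"
  shows "pless e x z"
  using assms(4,5) w_pl[OF assms(1,2), of e] unfolding pless_def by (auto split: if_splits)

lemma pless_asym:
  assumes "1 \<le> fst x" "1 \<le> fst y" "pless e x y" shows "\<not> pless e y x"
  using pless_trans[OF assms(1,2,1,3)] pless_irrefl by blast

lemma pless_total:
  assumes "x \<in> pts n" "y \<in> pts n" "x \<noteq> y"
  shows "pless e x y \<or> pless e y x"
proof -
  have "1 \<le> fst x" "1 \<le> fst y" "snd x \<le> 1" "snd y \<le> 1" using ptsD assms by auto
  with key_inj[of x y e] w_pl[of x y e] assms(3) show ?thesis
    unfolding pless_def by auto
qed

lemma pless_pl_le: "pless e x y \<Longrightarrow> pl e x \<le> pl e y"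
  by (auto simp: pless_def)

lemma betw_pl:
  assumes "pl e x = pl e z" "betw e x y z"
  shows "pl e y = pl e x"
  using assms unfolding betw_def by (auto dest!: pless_pl_le)

lemma betw_key:
  assumes "1 \<le> fst x" "1 \<le> fst y" "1 \<le> fst z" "pl e x = pl e z" "key e z < key e x"
  shows "betw e x y z \<longleftrightarrow> pl e y = pl e x \<and> key e z < key e y \<and> key e y < key e x"
proof
  assume b: "betw e x y z"
  have p: "pl e y = pl e x" using betw_pl b assms(4) by blast
  have "w (vtx e (fst x)) = w (vtx e (fst y))" "w (vtx e (fst x)) = w (vtx e (fst z))"
    using w_pl assms p by metis+
  with b p assms show "pl e y = pl e x \<and> key e z < key e y \<and> key e y < key e x"
    unfolding betw_def pless_def by (auto split: if_splits)
next
  assume p: "pl e y = pl e x \<and> key e z < key e y \<and> key e y < key e x"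
  have "w (vtx e (fst x)) = w (vtx e (fst y))" "w (vtx e (fst x)) = w (vtx e (fst z))"
    using w_pl assms p by metis+
  with p assms show "betw e x y z"
    unfolding betw_def pless_def by auto
qed

text \<open>For equal parities either vertex already decides. For opposite parities the two
  congruences would make \<open>L\<close> divide 2, against \<open>4 \<le> L\<close>.\<close>

lemma cell_eq:
  assumes "1 \<le> b" "1 \<le> c"
  shows "(\<forall>e. lab (vtx e b) = lab (vtx e c)) \<longleftrightarrow> int L dvd int b - int c"
proof
  assume *: "\<forall>e. lab (vtx e b) = lab (vtx e c)"
  then have d: "int L dvd int (vtx e b) - int (vtx e c)" for e
    using lab_eq even_vtx assms by metis
  show "int L dvd int b - int c"
  proof (cases "even b = even c")
    case True
    then show ?thesis using d[of "even b"] by (simp add: vtx_def)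
  next
    case False
    have "int L dvd int b - int (c - 1)" using d[of "even b"] False by (auto simp: vtx_def)
    moreover have "int L dvd int (b - 1) - int c"
      using d[of "\<not> even b"] False by (auto simp: vtx_def)
    ultimately have "int L dvd (int b - int (c - 1)) - (int (b - 1) - int c)"
      by (rule dvd_diff)
    moreover have "(int b - int (c - 1)) - (int (b - 1) - int c) = 2" using assms by simp
    ultimately have "int L dvd 2" by metis
    then have "(2::int) = 0" using dvd_abs_less_imp_0[of "int L" 2] L_ge by simp
    then show ?thesis by simp
  qed
next
  assume d: "int L dvd int b - int c"
  have p: "even b = even c" using dvd_even d .
  show "\<forall>e. lab (vtx e b) = lab (vtx e c)"
  proof
    fix e
    have "int (vtx e b) - int (vtx e c) = int b - int c"
      using assms p by (auto simp: vtx_def)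
    then show "lab (vtx e b) = lab (vtx e c)" using lab_eq even_vtx assms d by metis
  qed
qed

text \<open>The parity of a batch is constant on a cell, so there each \<open>rnk e\<close> shifts
  all batch numbers by the same amount.\<close>

lemma same_cell_key:
  assumes "1 \<le> fst x" "1 \<le> fst y" "snd x \<le> 1" "snd y \<le> 1" "int L dvd int (fst x) - int (fst y)"
  shows "key e x < key e y \<longleftrightarrow> fst x < fst y \<or> fst x = fst y \<and> snd y < snd x"
  using dvd_even[OF assms(5)] assms(1-4) unfolding key_def rnk_def by auto

lemma same_cell_pless:
  assumes "1 \<le> fst x" "1 \<le> fst y" "snd x \<le> 1" "snd y \<le> 1" "int L dvd int (fst x) - int (fst y)"
  shows "pless e x y \<longleftrightarrow> (if w (vtx e (fst x)) then key True y < key True x else key True x < key True y)"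
proof -
  have p: "pl e x = pl e y" unfolding pl_def using cell_eq assms by blast
  have d: "int L dvd int (fst y) - int (fst x)" using assms(5) dvd_diff_commute by blast
  show ?thesis unfolding pless_def using p same_cell_key assms d by auto
qed

text \<open>The points of a cell form a monotone sequence, whose betweenness relation is the same in
  both coordinates. Hence a batch separating two batches of one cell in one direction only lies
  outside that cell.\<close>

lemma same_cell_betw:
  assumes "1 \<le> fst x" "1 \<le> fst y" "1 \<le> fst z" "snd x \<le> 1" "snd y \<le> 1" "snd z \<le> 1"
    "int L dvd int (fst x) - int (fst y)" "int L dvd int (fst x) - int (fst z)"
  shows "betw e x y z = betw e' x y z"
proof -
  have d: "int L dvd int (fst y) - int (fst z)" using dvd_diff[OF assms(8,7)] by simp
  have d2: "int L dvd int (fst z) - int (fst y)" "int L dvd int (fst y) - int (fst x)"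
    using d assms(7) dvd_diff_commute by blast+
  have "w (vtx e (fst x)) = w (vtx e (fst y))" "w (vtx e (fst x)) = w (vtx e (fst z))" for e
    using w_pl cell_eq assms pl_def by metis+
  then show ?thesis unfolding betw_def using same_cell_pless assms d d2 by auto
qed

end

section \<open>Embeddings\<close>

text \<open>The map \<open>h\<close> injects the elements below \<open>a\<close> into those below
  \<open>h a\<close>, and likewise above; if \<open>a\<close> moved, one of these two sets would
  become smaller.\<close>

lemma strict_mono_on_finite_self:
  fixes h :: "nat \<Rightarrow> nat"
  assumes "finite A" "h ` A \<subseteq> A" "strict_mono_on A h" "a \<in> A"
  shows "h a = a"
proof -
  have inj: "inj_on h B" if "B \<subseteq> A" for B
    using assms(3) that strict_mono_on_imp_inj_on inj_on_subset by blast
  have "card {x\<in>A. x < a} \<le> card {x\<in>A. x < h a}"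
    using assms by (intro card_inj_on_le[OF inj]) (auto simp: strict_mono_on_def)
  moreover have "card {x\<in>A. a < x} \<le> card {x\<in>A. h a < x}"
    using assms by (intro card_inj_on_le[OF inj]) (auto simp: strict_mono_on_def)
  moreover have "card {x\<in>A. x < h a} < card {x\<in>A. x < a}" if "h a < a"
    using assms that by (intro psubset_card_mono) auto
  moreover have "card {x\<in>A. h a < x} < card {x\<in>A. a < x}" if "a < h a"
    using assms that by (intro psubset_card_mono) auto
  ultimately show ?thesis by (meson linorder_neqE_nat not_le)
qed

text \<open>The bound on \<open>m\<close> leaves room for \<open>L ^ L + 1\<close> blocks, one every
  three rounds of the cycle, for the pigeonhole argument in \<open>ex_window\<close>.\<close>

locale line_embedding = line_cycle +
  fixes m n :: nat and \<phi> :: "nat \<times> nat \<Rightarrow> nat \<times> nat"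
  assumes m_ge: "(3 * L ^ L + 10) * L \<le> m" and m_less: "m < n"
    and \<phi>_in: "x \<in> pts m \<Longrightarrow> \<phi> x \<in> pts n"
    and \<phi>_pless: "x \<in> pts m \<Longrightarrow> y \<in> pts m \<Longrightarrow> pless e x y \<Longrightarrow> pless e (\<phi> x) (\<phi> y)"
begin

text \<open>Only copy 0 is followed; the second copies of the end batches enter when the ends are
  compared.\<close>

definition f :: "nat \<Rightarrow> nat" where "f b = fst (\<phi> (b, 0))"

lemma \<phi>_bounds: "x \<in> pts m \<Longrightarrow> 1 \<le> fst (\<phi> x) \<and> fst (\<phi> x) \<le> n \<and> snd (\<phi> x) \<le> 1"
  using ptsD \<phi>_in by blast

lemma f_bounds: "1 \<le> b \<Longrightarrow> b \<le> m \<Longrightarrow> 1 \<le> f b \<and> f b \<le> n \<and> snd (\<phi> (b, 0)) \<le> 1"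
  unfolding f_def using \<phi>_bounds pts_0 by blast

lemma \<phi>_pless_iff:
  assumes "x \<in> pts m" "y \<in> pts m"
  shows "pless e (\<phi> x) (\<phi> y) \<longleftrightarrow> pless e x y"
  using \<phi>_pless assms pless_total[OF assms] pless_asym[of "\<phi> x" "\<phi> y" e] \<phi>_bounds pless_irrefl
  by metis

lemma \<phi>_inj: "x \<in> pts m \<Longrightarrow> y \<in> pts m \<Longrightarrow> \<phi> x = \<phi> y \<Longrightarrow> x = y"
  using pless_total[of x m y True] \<phi>_pless[of x y True] \<phi>_pless[of y x True] pless_irrefl by metis

lemma \<phi>_betw:
  assumes "x \<in> pts m" "y \<in> pts m" "z \<in> pts m"
  shows "betw e (\<phi> x) (\<phi> y) (\<phi> z) \<longleftrightarrow> betw e x y z"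
  unfolding betw_def using \<phi>_pless_iff assms by simp

text \<open>In each of its lines a cell is ordered by age, so \<open>b\<close> lies between
  \<open>b0\<close> and \<open>b1\<close>, and its image between theirs. Lines are intervals of the
  order, so the image of \<open>b\<close> cannot leave the common line.\<close>

lemma pl_squeeze:
  assumes "1 \<le> b0" "b0 \<le> b" "b \<le> b1" "b1 \<le> m"
    "int L dvd int b - int b0" "int L dvd int b1 - int b0"
    "pl e (\<phi> (b0, 0)) = pl e (\<phi> (b1, 0))"
  shows "pl e (\<phi> (b, 0)) = pl e (\<phi> (b0, 0))"
proof (cases "b = b0 \<or> b = b1")
  case False
  have d: "int L dvd int b1 - int b" using dvd_diff[OF assms(6,5)] by simp
  have "key e (b0, 0) < key e (b, 0)" "key e (b, 0) < key e (b1, 0)"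
    using same_cell_key[of "(b0, 0)" "(b, 0)" e] same_cell_key[of "(b, 0)" "(b1, 0)" e] assms(1-5) False
      d dvd_diff_commute[of "int L"] by auto
  moreover have "pl e (b, 0) = pl e (b1, 0)" "pl e (b1, 0) = pl e (b0, 0)"
    unfolding pl_def using cell_eq[of b1 b] cell_eq[of b1 b0] d assms by auto
  ultimately have "betw e (b1, 0) (b, 0) (b0, 0)"
    using betw_key[of "(b1, 0)" "(b, 0)" "(b0, 0)" e] assms by auto
  then have "betw e (\<phi> (b1, 0)) (\<phi> (b, 0)) (\<phi> (b0, 0))"
    using \<phi>_betw pts_0 assms by auto
  then show ?thesis using betw_pl assms(7) by metis
qed (use assms in auto)

text \<open>Over the four rounds starting at \<open>s\<close>, the cell of the image of a batch
  depends only on the cell of the batch.\<close>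

definition win :: "nat \<Rightarrow> bool" where
  "win s \<longleftrightarrow> 1 < s \<and> s + 4 * L \<le> m \<and>
     (\<forall>e b. s \<le> b \<longrightarrow> b < s + 3 * L \<longrightarrow> pl e (\<phi> (b, 0)) = pl e (\<phi> (b + L, 0)))"

lemma ex_window: "\<exists>s. win s"
proof -
  \<comment> \<open>The colour of block \<open>j\<close> records the cells of the images over the
    round starting at batch \<open>(3 * j + 1) * L + 1\<close>. Blocks three rounds apart make two
    blocks of equal colour enclose a window; the summand 1 in \<open>3 * j + 1\<close> keeps batch 1
    out of it.\<close>
  define col where "col j = map (\<lambda>k. f ((3 * j + 1) * L + 1 + k) mod L) [0..<L]" for j
  let ?C = "{xs. set xs \<subseteq> {..<L} \<and> length xs = L}"
  have "col ` {0..L ^ L} \<subseteq> ?C" using L_ge by (auto simp: col_def)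
  then have "card (col ` {0..L ^ L}) \<le> L ^ L"
    using card_mono[OF finite_lists_length_eq[of "{..<L}" L]] by (simp add: card_lists_length_eq)
  then have "\<not> inj_on col {0..L ^ L}" using pigeonhole[of col "{0..L ^ L}"] by simp
  then obtain i j where ij: "i < j" "j \<le> L ^ L" "col i = col j"
    unfolding inj_on_def by (metis atLeastAtMost_iff linorder_neqE_nat)
  define s where "s = (3 * i + 1) * L + 1"
  define D where "D = 3 * (j - i) * L"
  have s': "(3 * j + 1) * L + 1 = s + D"
    using ij(1) by (auto simp: s_def D_def algebra_simps diff_mult_distrib)
  have "1 * L \<le> (j - i) * L" using ij(1) by (intro mult_le_mono1) simp
  then have D: "3 * L \<le> D" by (simp add: D_def)
  have "j * L \<le> L ^ L * L" using mult_le_mono1[OF ij(2)] .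
  moreover have "3 * (L ^ L * L) + 10 * L \<le> m" using m_ge by (simp add: algebra_simps)
  moreover have "s + D = 3 * (j * L) + L + 1" unfolding s'[symmetric] by (simp add: algebra_simps)
  ultimately have m: "s + D + 2 * L \<le> m" using L_ge by linarith
  have eq: "f (s + k) mod L = f (s + D + k) mod L" if "k < L" for k
  proof -
    have "col i ! k = f (s + k) mod L" using that by (simp add: col_def s_def)
    moreover have "col j ! k = f (s + D + k) mod L"
      using that unfolding s'[symmetric] by (simp add: col_def)
    ultimately show ?thesis using ij by simp
  qed
  have "pl e (\<phi> (s + k, 0)) = pl e (\<phi> (s + D + k, 0))" if "k < L" for e k
  proof -
    have "int (f (s + k)) mod int L = int (f (s + D + k)) mod int L"
      using eq[OF that] by (metis of_nat_mod)
    then have "int L dvd int (f (s + k)) - int (f (s + D + k))"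
      using mod_eq_dvd_iff by blast
    moreover have "1 \<le> f (s + k)" "1 \<le> f (s + D + k)"
      using f_bounds[of "s + k"] f_bounds[of "s + D + k"] m that by (auto simp: s_def)
    ultimately show ?thesis
      unfolding pl_def using cell_eq[of "f (s + k)" "f (s + D + k)"] by (auto simp: f_def)
  qed note pe = this
  \<comment> \<open>Equal colours fix the lines at both ends, and \<open>pl_squeeze\<close> fixes
    them for all rounds in between.\<close>
  have const: "pl e (\<phi> (s + k + t * L, 0)) = pl e (\<phi> (s + k, 0))" if "k < L" "t \<le> 3" for e k t
  proof -
    have t: "t * L \<le> D" using order_trans[OF mult_le_mono1[OF that(2), of L] D] .
    show ?thesis
    proof (rule pl_squeeze[where ?b1.0 = "s + D + k"])
      show "int L dvd int (s + D + k) - int (s + k)" by (simp add: D_def)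
    qed (use pe that t m s_def in auto)
  qed
  have "pl e (\<phi> (b, 0)) = pl e (\<phi> (b + L, 0))" if "s \<le> b" "b < s + 3 * L" for e b
  proof -
    define k t where "k = (b - s) mod L" and "t = (b - s) div L"
    have b: "b = s + k + t * L" using that by (simp add: k_def t_def)
    have "t < 3" unfolding t_def using that L_ge by (intro less_mult_imp_div_less) simp
    moreover have "k < L" using L_ge by (simp add: k_def)
    ultimately show ?thesis using const[of k t e] const[of k "Suc t" e]
      by (simp add: b algebra_simps)
  qed
  moreover have "1 < s" using L_ge by (simp add: s_def)
  ultimately show ?thesis unfolding win_def using m D by (intro exI[of _ s]) auto
qed

text \<open>At the vertex shared by \<open>b\<close> and \<open>b + 1\<close>, the ranks of
  \<open>b + L\<close>, \<open>b + 1 + L\<close>, \<open>b\<close> are \<open>b + L + 1\<close>,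
  \<open>b + L\<close>, \<open>b + 1\<close>. In the other direction \<open>b\<close> and
  \<open>b + 1\<close> use the vertices \<open>b - 1\<close> and \<open>b + 1\<close>, which belong
  to different lines.\<close>

lemma shared_betw:
  assumes "1 \<le> b"
  shows "betw (even b) (b + L, 0) (Suc b + L, 0) (b, 0)"
    and "\<not> betw (odd b) (b + L, 0) (Suc b + L, 0) (b, 0)"
proof -
  let ?e = "even b"
  have v: "vtx ?e (b + L) = b + L" "vtx ?e (Suc b + L) = b + L" "vtx ?e b = b"
    using L_even by (auto simp: vtx_def)
  have r: "rnk ?e (b + L) = b + L + 1" "rnk ?e (Suc b + L) = b + L" "rnk ?e b = b + 1"
    using L_even by (auto simp: rnk_def)
  have "lab (b + L) = lab b" using lab_eq[of "b + L" b] L_even by simp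
  then have "pl ?e (b + L, 0) = pl ?e (b, 0)" "pl ?e (Suc b + L, 0) = pl ?e (b, 0)"
    unfolding pl_def using v by auto
  moreover have "key ?e (b, 0) < key ?e (Suc b + L, 0)" "key ?e (Suc b + L, 0) < key ?e (b + L, 0)"
    unfolding key_def using r L_ge by auto
  ultimately show "betw ?e (b + L, 0) (Suc b + L, 0) (b, 0)"
    using betw_key[of "(b + L, 0)" "(Suc b + L, 0)" "(b, 0)" ?e] assms by auto
  show "\<not> betw (\<not> ?e) (b + L, 0) (Suc b + L, 0) (b, 0)"
  proof
    assume *: "betw (\<not> ?e) (b + L, 0) (Suc b + L, 0) (b, 0)"
    have "pl (\<not> ?e) (b + L, 0) = pl (\<not> ?e) (b, 0)"
      unfolding pl_def using cell_eq[of "b + L" b] assms by simp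
    then have "pl (\<not> ?e) (Suc b + L, 0) = pl (\<not> ?e) (b, 0)" using * betw_pl by metis
    then have "int L dvd int (vtx (\<not> ?e) (Suc b + L)) - int (vtx (\<not> ?e) b)"
      using pl_eq[of "(Suc b + L, 0)" "(b, 0)" "\<not> ?e"] assms by simp
    moreover have "int (vtx (\<not> ?e) (Suc b + L)) - int (vtx (\<not> ?e) b) = 2 + int L"
      using assms L_even by (auto simp: vtx_def)
    ultimately have "int L dvd 2" by simp
    then show False using dvd_abs_less_imp_0[of "int L" 2] L_ge by simp
  qed
qed

section \<open>The closed walk traced by the images inside a window\<close>

context
  fixes s
  assumes win: "win s"
begin

lemma win_pts: "s \<le> b \<Longrightarrow> b < s + 4 * L \<Longrightarrow> 1 < b \<and> b < m \<and> (b, 0) \<in> pts m \<and> 1 \<le> f b"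
  using win pts_0 f_bounds unfolding win_def by auto

lemma win_pl: "s \<le> b \<Longrightarrow> b < s + 3 * L \<Longrightarrow> pl e (\<phi> (b + L, 0)) = pl e (\<phi> (b, 0))"
  using win unfolding win_def by auto

text \<open>The images of \<open>b + L\<close> and \<open>b\<close> lie on one line by periodicity,
  and the image of \<open>b + 1 + L\<close> lies between them.\<close>

lemma shared_pl:
  assumes "s \<le> b" "b + 1 < s + 3 * L"
  shows "pl (even b) (\<phi> (b, 0)) = pl (even b) (\<phi> (Suc b, 0))"
proof -
  have "betw (even b) (\<phi> (b + L, 0)) (\<phi> (Suc b + L, 0)) (\<phi> (b, 0))"
    using \<phi>_betw shared_betw(1)[of b] win_pts[of b] win_pts[of "b + L"] win_pts[of "Suc b + L"] assms
    by auto
  then have "pl (even b) (\<phi> (Suc b + L, 0)) = pl (even b) (\<phi> (b, 0))"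
    using betw_pl win_pl[of b] assms by (metis add_lessD1)
  then show ?thesis using win_pl[of "Suc b"] assms by simp
qed

text \<open>If two consecutive images had the same cell, the images of the three batches of
  \<open>shared_betw\<close> would all lie in it, where rows and columns agree on
  betweenness.\<close>

lemma no_fold:
  assumes "s \<le> b" "b + 1 < s + 3 * L"
  shows "\<not> int L dvd int (f b) - int (f (Suc b))"
proof
  assume d: "int L dvd int (f b) - int (f (Suc b))"
  have fp: "1 \<le> f b" "1 \<le> f (Suc b)" "1 \<le> f (b + L)" "1 \<le> f (Suc b + L)"
    using win_pts[of b] win_pts[of "Suc b"] win_pts[of "b + L"] win_pts[of "Suc b + L"] assms
    by auto
  have d1: "int L dvd int (f (b + L)) - int (f b)" "int L dvd int (f (Suc b + L)) - int (f (Suc b))"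
    using cell_eq[of "f (b + L)" "f b"] cell_eq[of "f (Suc b + L)" "f (Suc b)"] fp
      win_pl[of b] win_pl[of "Suc b"] assms unfolding pl_def f_def by auto
  have "int L dvd int (f (b + L)) - int (f (Suc b + L))"
    using dvd_diff[OF dvd_add[OF d1(1) d] d1(2)] by (simp add: algebra_simps)
  moreover have p: "(b, 0) \<in> pts m" "(b + L, 0) \<in> pts m" "(Suc b + L, 0) \<in> pts m"
    using win_pts[of b] win_pts[of "b + L"] win_pts[of "Suc b + L"] assms by auto
  ultimately have "betw (even b) (\<phi> (b + L, 0)) (\<phi> (Suc b + L, 0)) (\<phi> (b, 0)) =
      betw (odd b) (\<phi> (b + L, 0)) (\<phi> (Suc b + L, 0)) (\<phi> (b, 0))"
    using \<phi>_bounds d1(1) by (intro same_cell_betw) (auto simp: f_def)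
  then show False using shared_betw[of b] \<phi>_betw p win_pts[of b] assms by auto
qed

text \<open>Consecutive images share a vertex but not a cell, so they are the two edges at this
  vertex and the walk moves on by one. Whether it runs forward is decided by the parities of
  \<open>f b\<close> and \<open>b\<close>, and stays so.\<close>

lemma f_step:
  assumes "s \<le> b" "b + 1 < s + 3 * L"
  shows "int L dvd int (f (Suc b)) - int (f b) - (if even (f b) = even b then 1 else -1)"
    and "even (f (Suc b)) = even (Suc b) \<longleftrightarrow> even (f b) = even b"
proof -
  let ?e = "even b"
  have fp: "1 \<le> f b" "1 \<le> f (Suc b)" using win_pts[of b] win_pts[of "Suc b"] assms by auto
  have d: "int L dvd int (vtx ?e (f b)) - int (vtx ?e (f (Suc b)))"
    using shared_pl[OF assms] pl_eq fp unfolding f_def by blast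
  show p: "even (f (Suc b)) = even (Suc b) \<longleftrightarrow> even (f b) = even b"
  proof (rule ccontr)
    assume "\<not> ?thesis"
    then have "int (vtx ?e (f b)) - int (vtx ?e (f (Suc b))) = int (f b) - int (f (Suc b))"
      using fp by (auto simp: vtx_def)
    then show False using d no_fold[OF assms] by simp
  qed
  have "int (f (Suc b)) - int (f b) - (if even (f b) = even b then 1 else -1)
      = - (int (vtx ?e (f b)) - int (vtx ?e (f (Suc b))))"
    using p fp by (auto simp: vtx_def)
  then show "int L dvd int (f (Suc b)) - int (f b) - (if even (f b) = even b then 1 else -1)"
    using d by (metis dvd_minus_iff)
qed

lemma f_linear:
  assumes "j < 3 * L"
  shows "int L dvd int (f (s + j)) - int (f s) - (if even (f s) = even s then 1 else -1) * int j
    \<and> (even (f (s + j)) = even (s + j) \<longleftrightarrow> even (f s) = even s)"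
  using assms
proof (induction j)
  case (Suc j)
  let ?d = "if even (f s) = even s then 1 else - 1 :: int"
  have IH: "int L dvd int (f (s + j)) - int (f s) - ?d * int j"
    "even (f (s + j)) = even (s + j) \<longleftrightarrow> even (f s) = even s" using Suc by auto
  have st: "int L dvd int (f (Suc (s + j))) - int (f (s + j)) - ?d"
    "even (f (Suc (s + j))) = even (Suc (s + j)) \<longleftrightarrow> even (f (s + j)) = even (s + j)"
    using f_step[of "s + j"] Suc.prems IH(2) by auto
  have "int L dvd (int (f (s + j)) - int (f s) - ?d * int j)
      + (int (f (Suc (s + j))) - int (f (s + j)) - ?d)"
    using IH(1) st(1) dvd_add by blast
  moreover have "(int (f (s + j)) - int (f s) - ?d * int j)
      + (int (f (Suc (s + j))) - int (f (s + j)) - ?d)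
      = int (f (s + Suc j)) - int (f s) - ?d * int (Suc j)" by (simp add: algebra_simps)
  ultimately show ?case using IH(2) st(2) by (metis add_Suc_right)
qed simp

text \<open>Over one round, the map sending the line of a batch to the line of its image is
  injective on the rows (or the columns) of the cycle, since the walk is linear modulo
  \<open>L\<close>. It also respects their order, and a strictly monotone self-map of a finite set
  is the identity.\<close>

lemma line_fixed:
  assumes "s \<le> k" "k < s + L"
  shows "pl (even k) (\<phi> (k, 0)) = lab k"
proof -
  define e where "e = even k"
  define K where "K = {k. s \<le> k \<and> k < s + L \<and> even k = e}"
  have finK: "finite K" unfolding K_def by (rule finite_subset[of _ "{s..<s+L}"]) auto
  have Kf: "1 \<le> k \<and> 1 \<le> f k \<and> (k, 0) \<in> pts m" if "k \<in> K" for k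
    using win_pts[of k] that L_ge by (auto simp: K_def)
  have injl: "inj_on lab K"
  proof (rule inj_onI)
    fix k k' assume "k \<in> K" "k' \<in> K" "lab k = lab k'"
    then show "k = k'" using lab_eq[of k k'] dvd_abs_less_imp_0[of "int L" "int k - int k'"]
      by (auto simp: K_def)
  qed
  define c where "c k = pl e (\<phi> (k, 0))" for k
  have injc: "k = k'" if kk: "k \<in> K" "k' \<in> K" "c k = c k'" for k k'
  proof -
    have "int L dvd int (vtx e (f k)) - int (vtx e (f k'))"
      using kk(3) pl_eq Kf kk(1,2) unfolding c_def f_def by blast
    moreover define j j' where "j = k - s" and "j' = k' - s"
    have j: "k = s + j" "j < L" "k' = s + j'" "j' < L" using kk(1,2) by (auto simp: K_def j_def j'_def)
    let ?d = "if even (f s) = even s then 1 else - 1 :: int"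
    have lin: "int L dvd int (f k) - int (f s) - ?d * int j" "int L dvd int (f k') - int (f s) - ?d * int j'"
      "even (f k) = even k \<longleftrightarrow> even (f s) = even s" "even (f k') = even k' \<longleftrightarrow> even (f s) = even s"
      using f_linear[of j] f_linear[of j'] j by auto
    have "int (vtx e (f k)) - int (vtx e (f k')) = int (f k) - int (f k')"
      using lin(3,4) kk(1,2) Kf[of k] Kf[of k'] by (auto simp: K_def vtx_def)
    ultimately have "int L dvd (int (f k) - int (f k')) - ((int (f k) - int (f s) - ?d * int j)
        - (int (f k') - int (f s) - ?d * int j'))" using lin(1,2) by (metis dvd_diff)
    then have "int L dvd ?d * (int j - int j')" by (simp add: algebra_simps)
    then have "int L dvd int j - int j'" by (auto split: if_splits simp: dvd_diff_commute)
    then show ?thesis using dvd_abs_less_imp_0[of "int L" "int j - int j'"] j by auto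
  qed
  have range: "c k \<in> lab ` K" if "k \<in> K" for k
  proof -
    define v where "v = vtx e (f k)"
    define k' where "k' = s + nat ((int v - int s) mod int L)"
    have L0: "0 < int L" using L_ge by simp
    have k': "int k' = int s + (int v - int s) mod int L" unfolding k'_def using L0 by simp
    have d: "int L dvd int v - int k'"
      unfolding k' using dvd_minus_mod[of "int L" "int v - int s"] by (simp add: algebra_simps)
    have ev: "even v = e" using even_vtx Kf that v_def by blast
    have "even k' = e" using dvd_even[OF d] ev by simp
    moreover have "int k' < int s + int L" unfolding k' using L0 by simp
    moreover have "s \<le> k'" by (simp add: k'_def)
    ultimately have "k' \<in> K" by (simp add: K_def)
    moreover have "c k = lab k'" using lab_eq[of v k'] ev d \<open>even k' = e\<close>
      by (simp add: c_def pl_def v_def f_def)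
    ultimately show ?thesis by blast
  qed
  have mono: "c k < c k'" if "k \<in> K" "k' \<in> K" "lab k < lab k'" for k k'
  proof -
    have "pless e (k, 0) (k', 0)"
      using that by (auto simp: pless_def pl_def vtx_def K_def)
    then have "c k \<le> c k'" using \<phi>_pless Kf that pless_pl_le unfolding c_def by blast
    moreover have "c k \<noteq> c k'" using injc that by blast
    ultimately show ?thesis by simp
  qed
  define h where "h a = c (the_inv_into K lab a)" for a
  have h: "h (lab k) = c k" if "k \<in> K" for k
    unfolding h_def using the_inv_into_f_f[OF injl that] by simp
  have "h (lab k) = lab k"
  proof (rule strict_mono_on_finite_self)
    show "finite (lab ` K)" using finK by simp
    show "h ` lab ` K \<subseteq> lab ` K" using h range by auto
    show "strict_mono_on (lab ` K) h"
      by (rule strict_mono_onI) (use h mono in auto)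
    show "lab k \<in> lab ` K" using assms by (auto simp: K_def e_def)
  qed
  then show ?thesis using h[of k] assms by (auto simp: K_def e_def c_def)
qed

lemma f_cong:
  assumes "s \<le> b" "b < s + 3 * L"
  shows "int L dvd int (f b) - int b"
proof -
  have v: "int L dvd int (vtx (even k) (f k)) - int k" if "s \<le> k" "k < s + L" for k
  proof -
    have "1 \<le> f k" using win_pts that by simp
    then show ?thesis using line_fixed[OF that] even_vtx lab_eq[of "vtx (even k) (f k)" k]
      by (auto simp: pl_def f_def)
  qed
  have fs: "1 \<le> f s" "1 \<le> f (Suc s)" using win_pts[of s] win_pts[of "Suc s"] L_ge by auto
  \<comment> \<open>This excludes the reflected walk: it steps back by one, whereas fixed lines
    would make it step forward by one, so \<open>L\<close> would divide 2.\<close>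
  have e: "even (f s) = even s"
  proof (rule ccontr)
    assume ne: "even (f s) \<noteq> even s"
    then have ne': "even (f (Suc s)) \<noteq> even (Suc s)" using f_step(2)[of s] L_ge by auto
    have 1: "int L dvd int (f s) - 1 - int s" using v[of s] ne fs L_ge by (auto simp: vtx_def)
    have 2: "int L dvd int (f (Suc s)) - 1 - int (Suc s)"
      using v[of "Suc s"] ne' fs L_ge by (auto simp: vtx_def)
    have 3: "int L dvd int (f (Suc s)) - int (f s) - (- 1)" using f_step(1)[of s] ne L_ge by auto
    have "int L dvd (int (f (Suc s)) - int (f s) - (- 1))
        - ((int (f (Suc s)) - 1 - int (Suc s)) - (int (f s) - 1 - int s))"
      using 1 2 3 by (meson dvd_diff)
    then have "int L dvd 2" by simp
    then show False using dvd_abs_less_imp_0[of "int L" 2] L_ge by simp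
  qed
  have 1: "int L dvd int (f s) - int s" using v[of s] e L_ge by (simp add: vtx_def)
  have "int L dvd int (f (s + (b - s))) - int (f s) - 1 * int (b - s)"
    using f_linear[of "b - s"] e assms by auto
  then have "int L dvd (int (f b) - int (f s) - int (b - s)) + (int (f s) - int s)"
    using 1 assms dvd_add by (metis le_add_diff_inverse mult_1)
  then show ?thesis using assms by (simp add: algebra_simps of_nat_diff)
qed

lemma key_pres:
  assumes "x \<in> pts m" "y \<in> pts m" "pl e x = pl e y" "pl e (\<phi> x) = pl e x" "pl e (\<phi> y) = pl e y"
    "key e x < key e y"
  shows "key e (\<phi> x) < key e (\<phi> y)"
proof -
  have "1 \<le> fst x" "1 \<le> fst y" "1 \<le> fst (\<phi> x)" "1 \<le> fst (\<phi> y)" using ptsD \<phi>_bounds assms by auto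
  then have "w (vtx e (fst x)) = w (vtx e (fst y))" "w (vtx e (fst x)) = w (vtx e (fst (\<phi> x)))"
    "w (vtx e (fst x)) = w (vtx e (fst (\<phi> y)))" using w_pl assms by metis+
  then show ?thesis using assms \<phi>_pless[OF assms(1,2), of e] \<phi>_pless[OF assms(2,1), of e]
    unfolding pless_def by (auto split: if_splits)
qed

text \<open>Batches \<open>b\<close> and \<open>c\<close> share the line at vertex \<open>b\<close>,
  with ranks \<open>b + 1\<close> and \<open>c - 1\<close>; so do their images, and the order of
  keys carries over. The tie of ranks at \<open>c = b + 2\<close> is excluded by the
  congruence.\<close>

lemma f_compare:
  assumes "s \<le> b" "b < s + 3 * L" "s \<le> c" "c < s + 3 * L" "int L dvd int c - int b - 1"
  shows "int (f c) \<le> int (f b) + 1 \<longleftrightarrow> int c \<le> int b + 1"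
proof -
  let ?e = "even b"
  have bc: "1 < b" "1 < c" "1 \<le> f b" "1 \<le> f c" "(b, 0) \<in> pts m" "(c, 0) \<in> pts m"
    using win_pts[of b] win_pts[of c] assms by auto
  have ec: "even c \<noteq> even b"
  proof -
    have "int L dvd int c - int (Suc b)" using assms(5) by (simp add: algebra_simps)
    then show ?thesis using dvd_even by fastforce
  qed
  note fb = f_cong[OF assms(1,2)] and fc = f_cong[OF assms(3,4)]
  have ef: "even (f b) = even b" "even (f c) = even c" using dvd_even fb fc by blast+
  have "lab (c - 1) = lab b" using lab_eq[of "c - 1" b] ec bc assms(5) by (auto simp: algebra_simps of_nat_diff)
  then have p: "pl ?e (c, 0) = pl ?e (b, 0)" using ec by (auto simp: pl_def vtx_def)
  have pf: "pl ?e (\<phi> (b, 0)) = pl ?e (b, 0)" "pl ?e (\<phi> (c, 0)) = pl ?e (c, 0)"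
    using cell_eq[of "f b" b] cell_eq[of "f c" c] fb fc bc by (auto simp: pl_def f_def)
  have r: "rnk ?e b = b + 1" "rnk ?e c = c - 1" "rnk ?e (f b) = f b + 1" "rnk ?e (f c) = f c - 1"
    using ec ef by (auto simp: rnk_def)
  have "int L dvd ((int (f c) - int c) - (int (f b) - int b)) + (int c - int b - 1)"
    using fb fc assms(5) by (meson dvd_diff dvd_add)
  then have df: "int L dvd int (f c) - int (f b) - 1" by (simp add: algebra_simps)
  have nz: "int (f c) - int (f b) - 1 \<noteq> 1" "int c - int b - 1 \<noteq> 1"
    using df assms(5) L_ge dvd_abs_less_imp_0[of "int L" 1] by auto
  have sn: "snd (\<phi> (b, 0)) \<le> 1" "snd (\<phi> (c, 0)) \<le> 1" using \<phi>_bounds bc by auto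
  show ?thesis
  proof
    assume "int c \<le> int b + 1"
    then have "key ?e (c, 0) < key ?e (b, 0)" unfolding key_def using r bc by auto
    then have "key ?e (\<phi> (c, 0)) < key ?e (\<phi> (b, 0))" using key_pres p pf bc by simp
    then have "f c - 1 \<le> f b + 1" unfolding key_def using r sn by (auto simp: f_def)
    then show "int (f c) \<le> int (f b) + 1" using nz by auto
  next
    assume *: "int (f c) \<le> int (f b) + 1"
    show "int c \<le> int b + 1"
    proof (rule ccontr)
      assume "\<not> int c \<le> int b + 1"
      then have "key ?e (b, 0) < key ?e (c, 0)" unfolding key_def using r bc nz by auto
      then have "key ?e (\<phi> (b, 0)) < key ?e (\<phi> (c, 0))" using key_pres p pf bc by simp
      then have "f b + 1 \<le> f c - 1" unfolding key_def using r sn by (auto simp: f_def)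
      then show False using * by auto
    qed
  qed
qed

text \<open>In \<open>f_compare\<close>, \<open>c = b + 1\<close> shows that the displacement
  \<open>f b - b\<close> never increases. With \<open>c = b + 1 + L\<close> the image exceeds
  \<open>f b + 1\<close>, hence by at least \<open>L\<close>, which gives the reverse inequality;
  this look-ahead uses up the third round.\<close>

lemma f_shift:
  assumes "s \<le> b" "b < s + 2 * L"
  shows "int (f b) - int b = int (f s) - int s"
proof -
  have step: "int (f (Suc b)) - int (Suc b) \<le> int (f b) - int b" if "s \<le> b" "Suc b < s + 3 * L" for b
    using f_compare[of b "Suc b"] that by simp
  have anti: "int (f (b + j)) - int (b + j) \<le> int (f b) - int b" if "s \<le> b" "b + j < s + 3 * L" for b j
    using that(2)
  proof (induction j)
    case (Suc j)
    then show ?case using step[of "b + j"] that(1) by auto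
  qed simp
  have bck: "int (f b) - int b \<le> int (f (Suc b)) - int (Suc b)" if "s \<le> b" "Suc b < s + 2 * L" for b
  proof -
    have "\<not> int (f (Suc b + L)) \<le> int (f b) + 1"
      using f_compare[of b "Suc b + L"] that L_ge by simp
    moreover have "int L dvd ((int (f (Suc b + L)) - int (Suc b + L)) - (int (f b) - int b)) + int L"
      by (intro dvd_add dvd_diff[OF f_cong f_cong] dvd_refl) (use that in auto)
    then have "int L dvd int (f (Suc b + L)) - int (f b) - 1" by (simp add: algebra_simps)
    ultimately have "int L \<le> int (f (Suc b + L)) - int (f b) - 1"
      using zdvd_imp_le[of "int L" "int (f (Suc b + L)) - int (f b) - 1"] by simp
    moreover have "int (f (Suc b + L)) - int (Suc b + L) \<le> int (f (Suc b)) - int (Suc b)"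
      using anti[of "Suc b" L] that by simp
    ultimately show ?thesis by simp
  qed
  have "int (f (s + j)) - int (s + j) = int (f s) - int s" if "s + j < s + 2 * L" for j
    using that
  proof (induction j)
    case (Suc j)
    then show ?case using step[of "s + j"] bck[of "s + j"] by auto
  qed simp
  from this[of "b - s"] show ?thesis using assms by auto
qed

end

text \<open>Batch \<open>b + 1\<close> separates \<open>b\<close> from \<open>b - L\<close> on the
  line at vertex \<open>b\<close>, but not in the other direction. Its image does the same to the
  shifted pair, so it lies on their line outside their cell, where the ranks leave one candidate.
  The free \<open>u\<close> covers both copies of batch \<open>m\<close>.\<close>

lemma extend_forward:
  assumes "1 < b" "b < m" "L < b" "int L dvd g" "(Suc b, u) \<in> pts m"
    "int (f b) = int b + g" "int (f (b - L)) = int (b - L) + g"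
  shows "int (fst (\<phi> (Suc b, u))) = int (Suc b) + g"
proof -
  let ?e = "even b" and ?x = "(Suc b, u)"
  let ?y = "\<phi> ?x"
  have pm: "(b, 0) \<in> pts m" "(b - L, 0) \<in> pts m" using pts_0 assms by auto
  have u: "u \<le> 1" using ptsD assms(5) by fastforce
  have v: "vtx ?e (b - L) = b - L" "vtx ?e (Suc b) = b" "vtx ?e b = b"
    "vtx (\<not> ?e) (Suc b) = Suc b" "vtx (\<not> ?e) b = b - 1"
    using L_even assms(3) by (auto simp: vtx_def)
  have r: "rnk ?e (b - L) = b - L + 1" "rnk ?e (Suc b) = b" "rnk ?e b = b + 1"
    using L_even assms(3) by (auto simp: rnk_def)
  have dL: "int L dvd int b - int (b - L)" using assms(3) by simp
  have "lab b = lab (b - L)" using lab_eq[of b "b - L"] L_even assms(3) by simp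
  then have pls: "pl ?e (b, 0) = pl ?e (b - L, 0)" "pl ?e ?x = pl ?e (b, 0)"
    unfolding pl_def using v by auto
  have b1: "betw ?e (b, 0) ?x (b - L, 0)"
    using betw_key[of "(b, 0)" ?x "(b - L, 0)" ?e] pls assms(1,3) r L_ge u by (auto simp: key_def)
  have b2: "\<not> betw (\<not> ?e) (b, 0) ?x (b - L, 0)"
  proof
    assume *: "betw (\<not> ?e) (b, 0) ?x (b - L, 0)"
    have "pl (\<not> ?e) (b, 0) = pl (\<not> ?e) (b - L, 0)"
      unfolding pl_def using cell_eq[of b "b - L"] dL assms by simp
    then have "pl (\<not> ?e) ?x = pl (\<not> ?e) (b, 0)" using * betw_pl by metis
    then have "int L dvd int (Suc b) - int (b - 1)"
      using pl_eq[of ?x "(b, 0)" "\<not> ?e"] v assms by simp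
    moreover have "int (Suc b) - int (b - 1) = 2" using assms(1) by simp
    ultimately have "int L dvd 2" by simp
    then show False using dvd_abs_less_imp_0[of "int L" 2] L_ge by simp
  qed
  have i1: "betw ?e (\<phi> (b, 0)) ?y (\<phi> (b - L, 0))" "\<not> betw (\<not> ?e) (\<phi> (b, 0)) ?y (\<phi> (b - L, 0))"
    using b1 b2 \<phi>_betw pm assms(5) by auto
  have fb: "1 \<le> f b" "1 \<le> f (b - L)" "snd (\<phi> (b, 0)) \<le> 1" "snd (\<phi> (b - L, 0)) \<le> 1"
    and y: "1 \<le> fst ?y" "snd ?y \<le> 1"
    using \<phi>_bounds pm assms(5) by (auto simp: f_def)
  have dfb: "int L dvd int (f b) - int b" using assms(4,6) by simp
  have dff: "int L dvd int (f b) - int (f (b - L))" using assms(6,7) dL by simp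
  have ef: "even (f b) = ?e" "even (f (b - L)) = ?e"
    using dvd_even[OF dfb] dvd_even[OF dff] by simp_all
  have plf: "pl ?e (\<phi> (b, 0)) = pl ?e (\<phi> (b - L, 0))"
    using cell_eq[OF fb(1,2)] dff by (simp add: pl_def f_def)
  have rf: "rnk ?e (f b) = f b + 1" "rnk ?e (f (b - L)) = f (b - L) + 1"
    using ef by (auto simp: rnk_def)
  have "key ?e (\<phi> (b - L, 0)) < key ?e (\<phi> (b, 0))"
    unfolding key_def using rf assms(3,6,7) fb(4) L_ge by (auto simp: f_def)
  then have k: "pl ?e ?y = pl ?e (\<phi> (b, 0))" "key ?e (\<phi> (b - L, 0)) < key ?e ?y"
    "key ?e ?y < key ?e (\<phi> (b, 0))"
    using betw_key[of "\<phi> (b, 0)" ?y "\<phi> (b - L, 0)" ?e] i1(1) plf fb y by (auto simp: f_def)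
  have dv: "int L dvd int (vtx ?e (fst ?y)) - int (f b)"
    using k(1) pl_eq[of ?y "\<phi> (b, 0)" ?e] y fb ef by (simp add: f_def vtx_def)
  show ?thesis
  proof (cases "even (fst ?y) = ?e")
    case True
    then have d: "int L dvd int (f b) - int (fst ?y)"
      using dv dvd_diff_commute by (auto simp: vtx_def)
    have "betw ?e (\<phi> (b, 0)) ?y (\<phi> (b - L, 0)) = betw (\<not> ?e) (\<phi> (b, 0)) ?y (\<phi> (b - L, 0))"
      using fb y d dff by (intro same_cell_betw) (auto simp: f_def)
    then show ?thesis using i1 by simp
  next
    case False
    then have "rnk ?e (fst ?y) = fst ?y - 1" by (simp add: rnk_def)
    then have "f (b - L) + 1 \<le> fst ?y - 1" "fst ?y - 1 \<le> f b + 1"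
      using k(2,3)[THEN key_less_imp_rnk_le] rf by (simp_all add: f_def)
    then have "int b + g - int L + 2 \<le> int (fst ?y)" "int (fst ?y) \<le> int b + g + 2"
      using assms(3,6,7) y by auto
    moreover have "int L dvd int (fst ?y) - 1 - int (f b)" using dv False y by (auto simp: vtx_def)
    \<comment> \<open>The difference lies between \<open>1 - L\<close> and 1 and is divisible by
      \<open>L\<close>.\<close>
    ultimately have "int (fst ?y) - 1 - int (f b) = 0"
      using assms(6) L_ge by (intro dvd_abs_less_imp_0[of "int L"]) auto
    then show ?thesis using assms(6) by simp
  qed
qed

text \<open>The mirror image of the forward step: \<open>b - 1\<close> separates
  \<open>b + L\<close> from \<open>b\<close> only on the line that it shares with \<open>b\<close>.
  The free \<open>u\<close> covers both copies of batch 1.\<close>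

lemma extend_backward:
  assumes "1 < b" "b + L \<le> m" "int L dvd g" "(b - 1, u) \<in> pts m"
    "int (f b) = int b + g" "int (f (b + L)) = int (b + L) + g"
  shows "int (fst (\<phi> (b - 1, u))) = int (b - 1) + g"
proof -
  let ?e = "odd b" and ?x = "(b - 1, u)"
  let ?y = "\<phi> ?x"
  have pm: "(b, 0) \<in> pts m" "(b + L, 0) \<in> pts m" using pts_0 assms by auto
  have u: "u \<le> 1" using ptsD assms(4) by fastforce
  have v: "vtx ?e (b + L) = b + L - 1" "vtx ?e (b - 1) = b - 1" "vtx ?e b = b - 1"
    "vtx (\<not> ?e) (b - 1) = b - 1 - 1" "vtx (\<not> ?e) b = b"
    using L_even assms(1) by (auto simp: vtx_def)
  have r: "rnk ?e (b + L) = b + L - 1" "rnk ?e (b - 1) = b" "rnk ?e b = b - 1"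
    using L_even assms(1) by (auto simp: rnk_def)
  have "lab (b + L - 1) = lab (b - 1)" using lab_eq[of "b + L - 1" "b - 1"] L_even assms(1) by simp
  then have pls: "pl ?e (b + L, 0) = pl ?e (b, 0)" "pl ?e ?x = pl ?e (b + L, 0)"
    unfolding pl_def using v by auto
  have b1: "betw ?e (b + L, 0) ?x (b, 0)"
    using betw_key[of "(b + L, 0)" ?x "(b, 0)" ?e] pls assms(1) r L_ge u by (auto simp: key_def)
  have b2: "\<not> betw (\<not> ?e) (b + L, 0) ?x (b, 0)"
  proof
    assume *: "betw (\<not> ?e) (b + L, 0) ?x (b, 0)"
    have "pl (\<not> ?e) (b + L, 0) = pl (\<not> ?e) (b, 0)"
      unfolding pl_def using cell_eq[of "b + L" b] assms by simp
    then have "pl (\<not> ?e) ?x = pl (\<not> ?e) (b, 0)" using * betw_pl by metis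
    then have "int L dvd int (b - 1 - 1) - int b"
      using pl_eq[of ?x "(b, 0)" "\<not> ?e"] v assms by simp
    moreover have "int (b - 1 - 1) - int b = - 2" using assms(1) by simp
    ultimately have "int L dvd - 2" by metis
    then show False using dvd_abs_less_imp_0[of "int L" "-2"] L_ge by simp
  qed
  have i1: "betw ?e (\<phi> (b + L, 0)) ?y (\<phi> (b, 0))" "\<not> betw (\<not> ?e) (\<phi> (b + L, 0)) ?y (\<phi> (b, 0))"
    using b1 b2 \<phi>_betw pm assms(4) by auto
  have fb: "1 \<le> f b" "1 \<le> f (b + L)" "snd (\<phi> (b, 0)) \<le> 1" "snd (\<phi> (b + L, 0)) \<le> 1"
    and y: "1 \<le> fst ?y" "snd ?y \<le> 1"
    using \<phi>_bounds pm assms(4) by (auto simp: f_def)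
  have dfb: "int L dvd int (f b) - int b" using assms(3,5) by simp
  have dff: "int L dvd int (f (b + L)) - int (f b)" using assms(5,6) by simp
  have ef: "even (f b) = (\<not> ?e)" "even (f (b + L)) = (\<not> ?e)"
    using dvd_even[OF dfb] dvd_even[OF dff] by simp_all
  have plf: "pl ?e (\<phi> (b + L, 0)) = pl ?e (\<phi> (b, 0))"
    using cell_eq[OF fb(2,1)] dff by (simp add: pl_def f_def)
  have rf: "rnk ?e (f b) = f b - 1" "rnk ?e (f (b + L)) = f (b + L) - 1"
    using ef by (auto simp: rnk_def)
  have "f b < f (b + L) - 1" using assms(5,6) L_ge by linarith
  then have "key ?e (\<phi> (b, 0)) < key ?e (\<phi> (b + L, 0))"
    unfolding key_def using rf fb(1,3) by (auto simp: f_def)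
  then have k: "pl ?e ?y = pl ?e (\<phi> (b, 0))" "key ?e (\<phi> (b, 0)) < key ?e ?y"
    "key ?e ?y < key ?e (\<phi> (b + L, 0))"
    using betw_key[of "\<phi> (b + L, 0)" ?y "\<phi> (b, 0)" ?e] i1(1) plf fb y by (auto simp: f_def)
  have dv: "int L dvd int (vtx ?e (fst ?y)) - int (f b - 1)"
    using k(1) pl_eq[of ?y "\<phi> (b, 0)" ?e] y fb ef by (simp add: f_def vtx_def)
  show ?thesis
  proof (cases "even (fst ?y) = ?e")
    case False
    then have d0: "int L dvd int (fst ?y) - int (f b)"
      using dv y fb by (auto simp: vtx_def)
    have d: "int L dvd int (f (b + L)) - int (fst ?y)" using dvd_diff[OF dff d0] by simp
    have "betw ?e (\<phi> (b + L, 0)) ?y (\<phi> (b, 0)) = betw (\<not> ?e) (\<phi> (b + L, 0)) ?y (\<phi> (b, 0))"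
      using fb y d dff by (intro same_cell_betw) (auto simp: f_def)
    then show ?thesis using i1 by simp
  next
    case True
    then have "rnk ?e (fst ?y) = fst ?y + 1" by (simp add: rnk_def)
    then have "f b - 1 \<le> fst ?y + 1" "fst ?y + 1 \<le> f (b + L) - 1"
      using k(2,3)[THEN key_less_imp_rnk_le] rf by (simp_all add: f_def)
    then have "int b + g - 2 \<le> int (fst ?y)" "int (fst ?y) \<le> int b + int L + g - 2"
      using assms(5,6) y by auto
    moreover have "int L dvd int (fst ?y) - int (f b - 1)" using dv True by (auto simp: vtx_def)
    then have "int L dvd int (fst ?y) - (int (f b) - 1)" using fb by (simp add: of_nat_diff)
    ultimately have "int (fst ?y) - (int (f b) - 1) = 0"
      using assms(5) L_ge by (intro dvd_abs_less_imp_0[of "int L"]) auto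
    then show ?thesis using assms(1,5) by simp
  qed
qed

lemma embedding_False: False
proof -
  obtain s where s: "win s" using ex_window by blast
  have sm: "1 < s" "s + 4 * L \<le> m" using s by (auto simp: win_def)
  define g where "g = int (f s) - int s"
  have dg: "int L dvd g" using f_cong[OF s, of s] L_ge by (simp add: g_def)
  have mid: "int (f b) = int b + g" if "s \<le> b" "b < s + 2 * L" for b
    using f_shift[OF s that] by (simp add: g_def)
  have fw: "int (f b) = int b + g" if "s \<le> b" "b \<le> m" for b
    using that
  proof (induction b rule: less_induct)
    case (less b)
    show ?case
    proof (cases "b < s + 2 * L")
      case False
      define b' where "b' = b - 1"
      have b: "b = Suc b'" using False L_ge by (simp add: b'_def)
      have "int (f b') = int b' + g" "int (f (b' - L)) = int (b' - L) + g"
        using less False L_ge by (auto simp: b)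
      moreover have "1 < b'" "b' < m" "L < b'" "(Suc b', 0) \<in> pts m"
        using False sm L_ge less.prems pts_0[of "Suc b'" m] by (auto simp: b)
      ultimately show ?thesis using extend_forward[of b' g 0] dg by (auto simp: b f_def)
    qed (use less mid in auto)
  qed
  \<comment> \<open>A step down from \<open>s - i\<close> needs the value at
    \<open>s - i + L\<close>, which comes from \<open>fw\<close> if \<open>i \<le> L\<close> and
    from the induction hypothesis afterwards.\<close>
  have bw: "int (f (s - j)) = int (s - j) + g" if "j < s" for j
    using that
  proof (induction j rule: less_induct)
    case (less j)
    show ?case
    proof (cases j)
      case (Suc i)
      have "int (f (s - i + L)) = int (s - i + L) + g"
      proof (cases "i \<le> L")
        case True
        then show ?thesis using fw[of "s - i + L"] sm by auto
      next
        case False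
        have "s - (i - L) = s - i + L" using False less.prems Suc by auto
        then show ?thesis using less.IH[of "i - L"] False less.prems Suc L_ge by auto
      qed
      moreover have "int (f (s - i)) = int (s - i) + g" using less Suc by auto
      ultimately show ?thesis
        using extend_backward[of "s - i" g 0] dg pts_0 less sm Suc by (auto simp: f_def)
    qed (use fw sm in auto)
  qed
  have all: "int (f b) = int b + g" if "1 \<le> b" "b \<le> m" for b
    using bw[of "s - b"] fw[of b] that by (cases "b \<le> s") auto
  \<comment> \<open>Two points share a batch only if it is an end batch. Both copies of batch
    \<open>m\<close>, and both copies of batch 1, therefore go to an end batch.\<close>
  have dbl: "fst x = 1 \<or> fst x = k" if "x \<in> pts k" "y \<in> pts k" "x \<noteq> y" "fst x = fst y" for x y k
    using that by (auto simp: pts_def split: if_splits)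
  have p: "(m, 0) \<in> pts m" "(m, 1) \<in> pts m" "(1, 0) \<in> pts m" "(1, 1) \<in> pts m"
    using sm by (auto simp: pts_def)
  have "int (fst (\<phi> (m, 1))) = int m + g"
    using extend_forward[of "m - 1" g 1] all[of "m - 1"] all[of "m - 1 - L"] dg p sm L_ge by auto
  moreover have 1: "int (fst (\<phi> (m, 0))) = int m + g" using all[of m] sm by (auto simp: f_def)
  ultimately have "f m = 1 \<or> f m = n"
    using dbl[of "\<phi> (m, 0)" n "\<phi> (m, 1)"] \<phi>_in p \<phi>_inj[of "(m, 0)" "(m, 1)"] by (auto simp: f_def)
  moreover have "f m \<noteq> 1" using all[of m] all[of 1] f_bounds[of 1] sm by auto
  ultimately have mn: "int m + g = int n" using 1 by (auto simp: f_def)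
  have "int (fst (\<phi> (1, 1))) = 1 + g"
    using extend_backward[of 2 g 1] all[of 2] all[of "2 + L"] dg p sm L_ge by auto
  moreover have 2: "int (fst (\<phi> (1, 0))) = 1 + g" using all[of 1] sm by (auto simp: f_def)
  ultimately have "f 1 = 1 \<or> f 1 = n"
    using dbl[of "\<phi> (1, 0)" n "\<phi> (1, 1)"] \<phi>_in p \<phi>_inj[of "(1, 0)" "(1, 1)"] by (auto simp: f_def)
  moreover have "f 1 \<noteq> n" using mn 2 sm by (auto simp: f_def)
  \<comment> \<open>The last batch forces \<open>g = n - m\<close> and the first one
    \<open>g = 0\<close>.\<close>
  ultimately show False using 2 mn m_less by (auto simp: f_def)
qed

end

section \<open>Membership in a profile class\<close>

text \<open>By monotonicity the positions with label below \<open>k\<close> form an initial segment,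
  so membership is comparison with its size.\<close>

lemma card_label_less:
  fixes rl :: "nat \<Rightarrow> nat"
  assumes mono: "\<And>x y. x \<le> y \<Longrightarrow> y < N \<Longrightarrow> rl x \<le> rl y" and "x < N"
  shows "x < card {y. y < N \<and> rl y < k} \<longleftrightarrow> rl x < k"
proof
  assume "rl x < k"
  then have "{..x} \<subseteq> {y. y < N \<and> rl y < k}" using mono[OF _ \<open>x < N\<close>] \<open>x < N\<close> by fastforce
  then have "card {..x} \<le> card {y. y < N \<and> rl y < k}" by (intro card_mono) auto
  then show "x < card {y. y < N \<and> rl y < k}" by simp
next
  assume *: "x < card {y. y < N \<and> rl y < k}"
  show "rl x < k"
  proof (rule ccontr)
    assume "\<not> rl x < k"
    then have "y < x" if "y < N" "rl y < k" for y using mono[of x y] that by (cases "x \<le> y") auto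
    then have "{y. y < N \<and> rl y < k} \<subseteq> {..<x}" by blast
    then have "card {y. y < N \<and> rl y < k} \<le> card {..<x}" by (intro card_mono) auto
    with * show False by simp
  qed
qed

text \<open>The cut number \<open>k\<close> counts the positions with label below \<open>k\<close>;
  a label that does not occur gives an empty interval.\<close>

lemma label_cuts:
  fixes rl :: "nat \<Rightarrow> nat"
  assumes mono: "\<And>x y. x \<le> y \<Longrightarrow> y < N \<Longrightarrow> rl x \<le> rl y" and lt: "\<And>x. x < N \<Longrightarrow> rl x < r"
  shows "\<exists>I. length I = r + 1 \<and> sorted I \<and> hd I = 0 \<and> last I = N \<and>
    (\<forall>k<r. {I ! k..<I ! (k + 1)} = {x. x < N \<and> rl x = k})"
proof (intro exI conjI allI impI)
  define c where "c k = card {y. y < N \<and> rl y < k}" for k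
  define I where "I = map c [0..<r + 1]"
  show "length I = r + 1" by (simp add: I_def)
  have "c k \<le> c l" if "k \<le> l" for k l
    unfolding c_def using that by (intro card_mono) auto
  then show "sorted I" unfolding I_def by (simp add: sorted_iff_nth_mono nth_append del: upt_Suc)
  show "hd I = 0" by (simp add: I_def c_def hd_map del: upt_Suc)
  have "{y. y < N \<and> rl y < r} = {..<N}" using lt by auto
  then show "last I = N" by (simp add: I_def c_def)
  have cN: "c k \<le> N" for k
    unfolding c_def using card_mono[of "{..<N}" "{y. y < N \<and> rl y < k}"] by auto
  fix k assume "k < r"
  then have "I ! k = c k" "I ! (k + 1) = c (k + 1)" by (auto simp: I_def simp del: upt_Suc)
  moreover have "x < c k \<longleftrightarrow> x < N \<and> rl x < k" for x k
    using card_label_less[of N rl x k, OF mono] cN[of k] unfolding c_def by fastforce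
  ultimately show "{I ! k..<I ! (k + 1)} = {x. x < N \<and> rl x = k}"
    by (auto simp: not_less[symmetric] simp del: not_less) 
qed

text \<open>An M-partition amounts to monotone labellings of positions by rows of \<open>M\<close>
  and of values by columns of \<open>M\<close>. The empty cells are handled by \<open>nz\<close>,
  from the side of the points.\<close>

lemma profile_classI:
  assumes "is_perm p"
    and rmono: "\<And>x y. x \<le> y \<Longrightarrow> y < length p \<Longrightarrow> rl x \<le> rl y"
    and cmono: "\<And>x y. x \<le> y \<Longrightarrow> y < length p \<Longrightarrow> cl x \<le> cl y"
    and rlt: "\<And>x. x < length p \<Longrightarrow> rl x < dim_row M"
    and clt: "\<And>x. x < length p \<Longrightarrow> cl x < dim_col M"
    and nz: "\<And>x. x < length p \<Longrightarrow> M $$ (rl x, cl (p ! x)) \<noteq> 0"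
    and inc: "\<And>x y. x < y \<Longrightarrow> y < length p \<Longrightarrow> rl x = rl y \<Longrightarrow> cl (p ! x) = cl (p ! y) \<Longrightarrow>
      M $$ (rl x, cl (p ! x)) = 1 \<Longrightarrow> p ! x < p ! y"
    and dec: "\<And>x y. x < y \<Longrightarrow> y < length p \<Longrightarrow> rl x = rl y \<Longrightarrow> cl (p ! x) = cl (p ! y) \<Longrightarrow>
      M $$ (rl x, cl (p ! x)) = -1 \<Longrightarrow> p ! y < p ! x"
  shows "p \<in> profile_class M"
proof -
  let ?N = "length p" and ?P = "perm_matrix p"
  have "\<exists>I. length I = dim_row M + 1 \<and> sorted I \<and> hd I = 0 \<and> last I = ?N \<and>
    (\<forall>k<dim_row M. {I ! k..<I ! (k + 1)} = {x. x < ?N \<and> rl x = k})"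
    by (rule label_cuts, erule rmono, assumption, erule rlt)
  then obtain I where I: "length I = dim_row M + 1 \<and> sorted I \<and> hd I = 0 \<and> last I = ?N \<and>
    (\<forall>k<dim_row M. {I ! k..<I ! (k + 1)} = {x. x < ?N \<and> rl x = k})" ..
  have "\<exists>J. length J = dim_col M + 1 \<and> sorted J \<and> hd J = 0 \<and> last J = ?N \<and>
    (\<forall>k<dim_col M. {J ! k..<J ! (k + 1)} = {x. x < ?N \<and> cl x = k})"
    by (rule label_cuts, erule cmono, assumption, erule clt)
  then obtain J where J: "length J = dim_col M + 1 \<and> sorted J \<and> hd J = 0 \<and> last J = ?N \<and>
    (\<forall>k<dim_col M. {J ! k..<J ! (k + 1)} = {x. x < ?N \<and> cl x = k})" ..
  have dim: "dim_row ?P = ?N" "dim_col ?P = ?N" by (auto simp: perm_matrix_def)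
  have cells: "(M $$ (k, l) = 0 \<longrightarrow> zero_matrix B) \<and> (M $$ (k, l) = 1 \<longrightarrow> increasing_matrix B) \<and>
      (M $$ (k, l) = -1 \<longrightarrow> decreasing_matrix B)"
    if kl: "k < dim_row M" "l < dim_col M"
      and B: "B = submatrix ?P {I ! k..<I ! (k + 1)} {J ! l..<J ! (l + 1)}" for k l B
  proof -
    define S where "S = {x. x < ?N \<and> rl x = k}"
    define T where "T = {x. x < ?N \<and> cl x = l}"
    have B': "B = submatrix ?P S T" using B I J kl S_def T_def by simp
    have S': "{i. i < dim_row ?P \<and> i \<in> S} = S" and T': "{i. i < dim_col ?P \<and> i \<in> T} = T"
      by (auto simp: dim S_def T_def)
    have dB: "dim_row B = card S" "dim_col B = card T"
      unfolding B' dim_submatrix using S' T' by simp_all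
    have entry: "p ! pick S i = pick T j \<and> pick S i < ?N \<and> rl (pick S i) = k \<and> cl (pick T j) = l"
      if "i < card S" "j < card T" "B $$ (i, j) \<noteq> 0" for i j
    proof -
      have st: "pick S i \<in> S" "pick T j \<in> T" using pick_in_set_le that by auto
      then have "B $$ (i, j) = (if p ! pick S i = pick T j then 1 else 0)"
        unfolding B' using that S' T' submatrix_index[of i ?P S j T]
        by (simp add: perm_matrix_def S_def T_def)
      then show ?thesis using that st by (auto simp: S_def T_def split: if_splits)
    qed
    have pT: "j < j'" if "pick T j < pick T j'" "j < card T" "j' < card T" for j j'
    proof (rule ccontr)
      assume "\<not> j < j'"
      then have "pick T j' \<le> pick T j" using pick_mono_le[of j T j'] that by (cases "j = j'") auto
      then show False using that by simp
    qed
    have "zero_matrix B" if "M $$ (k, l) = 0"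
      unfolding zero_matrix_def
    proof (rule eq_matI)
      fix i j assume ij: "i < dim_row (0\<^sub>m (dim_row B) (dim_col B))" "j < dim_col (0\<^sub>m (dim_row B) (dim_col B))"
      show "B $$ (i, j) = 0\<^sub>m (dim_row B) (dim_col B) $$ (i, j)"
      proof (rule ccontr)
        assume "B $$ (i, j) \<noteq> 0\<^sub>m (dim_row B) (dim_col B) $$ (i, j)"
        then have "B $$ (i, j) \<noteq> 0" using ij by simp
        then show False using entry[of i j] ij nz[of "pick S i"] that by (auto simp: dB)
      qed
    qed auto
    moreover have "increasing_matrix B" if "M $$ (k, l) = 1"
      unfolding increasing_matrix_def dB
    proof (intro allI impI)
      fix i i' j j' assume *: "i < card S" "i' < card S" "j < card T" "j' < card T"
        "B $$ (i, j) \<noteq> 0 \<and> B $$ (i', j') \<noteq> 0 \<and> i < i'"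
      have "pick S i < pick S i'" using pick_mono_le * by blast
      then have "pick T j < pick T j'"
        using entry[of i j] entry[of i' j'] * that inc[of "pick S i" "pick S i'"] by metis
      then show "j < j'" using pT * by blast
    qed
    moreover have "decreasing_matrix B" if "M $$ (k, l) = -1"
      unfolding decreasing_matrix_def dB
    proof (intro allI impI)
      fix i i' j j' assume *: "i < card S" "i' < card S" "j < card T" "j' < card T"
        "B $$ (i, j) \<noteq> 0 \<and> B $$ (i', j') \<noteq> 0 \<and> i < i'"
      have "pick S i < pick S i'" using pick_mono_le * by blast
      then have "pick T j' < pick T j"
        using entry[of i j] entry[of i' j'] * that dec[of "pick S i" "pick S i'"] by metis
      then show "j' < j" using pT * by blast
    qed
    ultimately show ?thesis by blast
  qed
  have "M_partition M ?P I J" unfolding M_partition_def dim Let_def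
    using I J cells by blast
  then show ?thesis unfolding profile_class_def using assms(1) by blast
qed

section \<open>Permutations from two linear orders on one set\<close>

definition idx :: "'a list \<Rightarrow> 'a \<Rightarrow> nat" where
  "idx ys x = (THE j. j < length ys \<and> ys ! j = x)"

text \<open>The list \<open>xs\<close> gives the order from top to bottom, \<open>ys\<close> the
  order of the same elements from left to right.\<close>

definition perm_of :: "'a list \<Rightarrow> 'a list \<Rightarrow> nat list" where
  "perm_of xs ys = map (idx ys) xs"

lemma idx_nth: "distinct ys \<Longrightarrow> j < length ys \<Longrightarrow> idx ys (ys ! j) = j"
  unfolding idx_def using nth_eq_iff_index_eq by (intro the_equality) auto

lemma nth_idx: "distinct ys \<Longrightarrow> x \<in> set ys \<Longrightarrow> idx ys x < length ys \<and> ys ! idx ys x = x"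
  by (metis idx_nth in_set_conv_nth)

lemma is_perm_perm_of:
  assumes "distinct xs" "distinct ys" "set xs = set ys"
  shows "is_perm (perm_of xs ys)"
proof -
  have "inj_on (idx ys) (set xs)" using nth_idx[OF assms(2)] assms(3) by (metis inj_onI)
  then have "distinct (perm_of xs ys)" by (simp add: perm_of_def distinct_map assms)
  moreover have len: "length xs = length ys" using assms distinct_card by metis
  have "idx ys ` set ys = {..<length ys}"
  proof
    show "idx ys ` set ys \<subseteq> {..<length ys}" using nth_idx[OF assms(2)] by auto
    show "{..<length ys} \<subseteq> idx ys ` set ys"
      using idx_nth[OF assms(2)] nth_mem by (metis image_eqI lessThan_iff subsetI)
  qed
  then have "set (perm_of xs ys) = {..<length (perm_of xs ys)}"
    by (simp add: perm_of_def assms(3) len)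
  ultimately show ?thesis by (simp add: is_perm_def permutations_of_set_def)
qed

lemma sorted_wrt_less_iff_idx:
  assumes "sorted_wrt R ys" "distinct ys" "x \<in> set ys" "y \<in> set ys"
    and asym: "\<And>x y. x \<in> set ys \<Longrightarrow> y \<in> set ys \<Longrightarrow> R x y \<Longrightarrow> \<not> R y x"
  shows "R x y \<longleftrightarrow> idx ys x < idx ys y"
proof -
  have "idx ys x < idx ys y \<Longrightarrow> R x y" if "x \<in> set ys" "y \<in> set ys" for x y
    using sorted_wrt_nth_less[OF assms(1)] nth_idx[OF assms(2)] that by metis
  then show ?thesis using asym nth_idx[OF assms(2)] assms(3,4) by (metis linorder_neqE_nat)
qed

lemma sorted_wrt_concat_map:
  assumes "\<And>b. b \<in> set bs \<Longrightarrow> sorted_wrt R (g b)" "sorted_wrt Q bs"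
    "\<And>b c x y. b \<in> set bs \<Longrightarrow> c \<in> set bs \<Longrightarrow> Q b c \<Longrightarrow> x \<in> set (g b) \<Longrightarrow> y \<in> set (g c) \<Longrightarrow> R x y"
  shows "sorted_wrt R (concat (map g bs))"
  using assms
proof (induction bs)
  case (Cons b bs)
  have "sorted_wrt R (concat (map g bs))"
  proof (rule Cons.IH)
    show "R x y" if "b \<in> set bs" "c \<in> set bs" "Q b c" "x \<in> set (g b)" "y \<in> set (g c)" for b c x y
      using Cons.prems(3)[of b c x y] that by simp
  qed (use Cons.prems(1,2) in auto)
  moreover have "R x y" if "c \<in> set bs" "x \<in> set (g b)" "y \<in> set (g c)" for c x y
    using Cons.prems(2) Cons.prems(3)[of b c x y] that by simp
  ultimately show ?case using Cons.prems(1)[of b] by (auto simp: sorted_wrt_append)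
qed simp

lemma sorted_wrt_irrefl_distinct:
  "sorted_wrt R xs \<Longrightarrow> (\<And>x. \<not> R x x) \<Longrightarrow> distinct xs"
  by (induction xs) auto

text \<open>Cut after the longest prefix of elements preceding \<open>b\<close>; the next element
  follows \<open>b\<close>, and so do all later ones by transitivity.\<close>

lemma sorted_insert_at:
  assumes "sorted_wrt R xs"
    and tot: "\<And>x. x \<in> set xs \<Longrightarrow> R x b \<or> R b x"
    and trans: "\<And>x y. x \<in> set xs \<Longrightarrow> y \<in> set xs \<Longrightarrow> R b x \<Longrightarrow> R x y \<Longrightarrow> R b y"
  obtains t where "t \<le> length xs" "\<forall>k\<in>set (take t xs). R k b" "\<forall>k\<in>set (drop t xs). R b k"
proof
  let ?t = "length (takeWhile (\<lambda>k. R k b) xs)"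
  show "?t \<le> length xs" by (rule length_takeWhile_le)
  show "\<forall>k\<in>set (take ?t xs). R k b"
    by (simp add: takeWhile_eq_take[symmetric]) (metis set_takeWhileD)
  have d: "drop ?t xs = dropWhile (\<lambda>k. R k b) xs" by (simp add: dropWhile_eq_drop)
  show "\<forall>k\<in>set (drop ?t xs). R b k"
  proof (cases "dropWhile (\<lambda>k. R k b) xs")
    case (Cons h ys)
    have so: "sorted_wrt R (h # ys)" using assms(1) sorted_wrt_drop d Cons by metis
    have sub: "set (h # ys) \<subseteq> set xs" using set_drop_subset d Cons by metis
    have "\<not> R h b" using hd_dropWhile[of "\<lambda>k. R k b" xs] Cons by auto
    then have h: "R b h" using tot[of h] sub by simp
    have "R b k" if "k \<in> set ys" for k using trans[of h k] h so sub that by auto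
    then show ?thesis unfolding d Cons using h by simp
  next
    case Nil
    show ?thesis unfolding d Nil by simp
  qed
qed

section \<open>Permutations from a cycle of lines\<close>

context line_cycle
begin

text \<open>A rank differs from the batch number by at most one, so passing from age to rank inverts
  neighbours only.\<close>

lemma rnk_less_imp: "k < b \<Longrightarrow> rnk e b < rnk e k \<Longrightarrow> k = b - 1"
  by (auto simp: rnk_def split: if_splits)

text \<open>This is the ban on overtaking, in terms of ranks. The shared vertex must be
  \<open>b - 1\<close>, since the vertices \<open>b\<close> and \<open>b - 2\<close> lie on
  different lines.\<close>

lemma shared_rnk:
  assumes "2 \<le> b" "lab (vtx e b) = lab (vtx e (b - 1))"
  shows "rnk e b < rnk e (b - 1)"
proof (cases "even b = e")
  case True
  obtain c where b: "b = Suc (Suc c)" using assms(1) by (metis add_2_eq_Suc le_iff_add)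
  have "vtx e b = b" "vtx e (b - 1) = c" using True by (auto simp: vtx_def b)
  then have "int L dvd int b - int c" using lab_eq[of b c] assms(2) by (simp add: b)
  then have "int L dvd 2" by (simp add: b)
  then show ?thesis using dvd_abs_less_imp_0[of "int L" 2] L_ge by simp
next
  case False
  then show ?thesis using assms(1) by (auto simp: rnk_def)
qed

definition ord :: "bool \<Rightarrow> nat \<Rightarrow> nat list" where
  "ord e n = batch_order (\<lambda>b. lab (vtx e b)) (\<lambda>b. w (vtx e b)) n"

lemma pless_0:
  "pless e (b, 0) (c, 0) \<longleftrightarrow> lab (vtx e b) < lab (vtx e c) \<or> lab (vtx e b) = lab (vtx e c) \<and>
     (if w (vtx e b) then rnk e c < rnk e b else rnk e b < rnk e c)"
  by (simp add: pless_def pl_def key_def)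

text \<open>The sorted position \<open>t0\<close> is admissible. It is also extremal: a batch that
  would have to be passed to get closer to the yearn lies on another line or is batch
  \<open>b - 1\<close>, which must not be overtaken.\<close>

lemma ord_Suc_Suc:
  assumes st: "set xs = {1..Suc n}" and di: "distinct xs"
    and so: "sorted_wrt (\<lambda>b c. pless e (b, 0) (c, 0)) xs"
  defines "b \<equiv> Suc (Suc n)"
  defines "S \<equiv> batch_slots (\<lambda>b. lab (vtx e b)) (\<lambda>b. w (vtx e b)) xs b"
  defines "t \<equiv> if w (vtx e b) then Min S else Max S"
  shows "sorted_wrt (\<lambda>b c. pless e (b, 0) (c, 0)) (take t xs @ [b] @ drop t xs)"
proof -
  let ?R = "\<lambda>b c. pless e (b, 0) (c, 0)"
  have ks: "1 \<le> k \<and> k < b" if "k \<in> set xs" for k using that st by (auto simp: b_def)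
  have tot: "?R x b \<or> ?R b x" if "x \<in> set xs" for x
    using pless_total[of "(x, 0)" b "(b, 0)" e] ks[OF that] pts_0 by auto
  have trans: "?R x z" if "?R x y" "?R y z" "1 \<le> x" "1 \<le> y" "1 \<le> z" for x y z
    using pless_trans[of "(x, 0)" "(y, 0)" "(z, 0)" e] that by auto
  obtain t0 where t0: "t0 \<le> length xs" "\<forall>k\<in>set (take t0 xs). ?R k b" "\<forall>k\<in>set (drop t0 xs). ?R b k"
    by (rule sorted_insert_at[OF so tot]) (use ks trans in \<open>auto simp: b_def\<close>)
  have as: "\<not> (?R k b \<and> ?R b k)" if "k \<in> set xs" for k
    using pless_asym[of "(k, 0)" "(b, 0)" e] ks[OF that] by auto
  have td: "k \<in> set (take t0 xs) \<or> k \<in> set (drop t0 xs)" if "k \<in> set xs" for k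
    using that by (metis Un_iff append_take_drop_id set_append)
  have tk: "?R k b \<Longrightarrow> k \<in> set (take t0 xs)" "?R b k \<Longrightarrow> k \<in> set (drop t0 xs)" if "k \<in> set xs" for k
    using td[OF that] as[OF that] t0 by auto
  have b1: "b - 1 \<in> set xs" using st by (auto simp: b_def)
  have wb: "w (vtx e b) = w (vtx e k)" if "k \<in> set xs" "lab (vtx e b) = lab (vtx e k)" for k
    using w_pl[of "(b, 0)" "(k, 0)" e] ks[OF that(1)] that(2) by (auto simp: pl_def)
  have "t0 \<in> S"
    unfolding S_def batch_slots_def
  proof (intro CollectI conjI ballI impI)
    show "t0 \<le> length xs" by fact
    show "k \<in> set (take t0 xs)" if "k \<in> set xs" "lab (vtx e k) < lab (vtx e b)" for k
      using tk that by (auto simp: pless_0)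
    show "k \<in> set (drop t0 xs)" if "k \<in> set xs" "lab (vtx e b) < lab (vtx e k)" for k
      using tk that by (auto simp: pless_0)
    assume l: "lab (vtx e b) = lab (vtx e (b - 1))"
    then have "rnk e b < rnk e (b - 1)" using shared_rnk[of b e] by (simp add: b_def)
    then show "if w (vtx e b) then b - 1 \<in> set (take t0 xs) else b - 1 \<in> set (drop t0 xs)"
      using tk[OF b1] wb[OF b1 l] l by (auto simp: pless_0)
  qed
  moreover have "finite S" by (rule finite_subset[of _ "{..length xs}"]) (auto simp: S_def batch_slots_def)
  moreover have "t0 \<le> t'" if "t' \<in> S" "w (vtx e b)" for t'
  proof (rule ccontr)
    assume "\<not> t0 \<le> t'"
    then have lt: "t' < t0" "t' < length xs" using t0(1) by auto
    define k where "k = xs ! t'"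
    have "take t0 xs ! t' = k" using lt by (simp add: k_def)
    then have k: "k \<in> set xs" "k \<in> set (take t0 xs)"
      using lt nth_mem[of t' "take t0 xs"] by (auto simp: k_def)
    then have R: "?R k b" using t0 by blast
    have "k \<in> set (take t' xs)"
    proof (cases "lab (vtx e k) < lab (vtx e b)")
      case True
      then show ?thesis using that(1) k by (auto simp: S_def batch_slots_def)
    next
      case False
      then have l: "lab (vtx e b) = lab (vtx e k)" "rnk e b < rnk e k"
        using R wb[OF k(1)] that(2) by (auto simp: pless_0)
      then have "k = b - 1" using rnk_less_imp ks[OF k(1)] by blast
      then show ?thesis using that l(1) by (auto simp: S_def batch_slots_def)
    qed
    then show False using di lt nth_eq_iff_index_eq by (fastforce simp: k_def in_set_conv_nth)
  qed
  moreover have "t' \<le> t0" if "t' \<in> S" "\<not> w (vtx e b)" for t'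
  proof (rule ccontr)
    assume "\<not> t' \<le> t0"
    moreover have "t' \<le> length xs" using that(1) by (auto simp: S_def batch_slots_def)
    ultimately have lt: "t0 < t'" "t' \<le> length xs" by auto
    define k where "k = xs ! t0"
    have "drop t0 xs ! 0 = k" using lt by (simp add: k_def)
    then have k: "k \<in> set xs" "k \<in> set (drop t0 xs)"
      using lt nth_mem[of 0 "drop t0 xs"] by (auto simp: k_def)
    then have R: "?R b k" using t0 by blast
    have "k \<in> set (drop t' xs)"
    proof (cases "lab (vtx e b) < lab (vtx e k)")
      case True
      then show ?thesis using that(1) k by (auto simp: S_def batch_slots_def)
    next
      case False
      then have l: "lab (vtx e b) = lab (vtx e k)" "rnk e b < rnk e k"
        using R that(2) by (auto simp: pless_0)
      then have "k = b - 1" using rnk_less_imp ks[OF k(1)] by blast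
      then show ?thesis using that l(1) by (auto simp: S_def batch_slots_def)
    qed
    moreover have "k \<in> set (take t' xs)" using lt by (auto simp: k_def in_set_conv_nth)
    ultimately show False using set_take_disj_set_drop_if_distinct[OF di, of t' t'] by auto
  qed
  ultimately have "t = t0" unfolding t_def
    by (auto intro!: Min_eqI Max_eqI)
  moreover have "sorted_wrt ?R (take t0 xs @ [b] @ drop t0 xs)"
  proof -
    have "sorted_wrt ?R (take t0 xs @ drop t0 xs)" using so by simp
    then show ?thesis using t0 unfolding sorted_wrt_append by auto
  qed
  ultimately show ?thesis by simp
qed

lemma ord_sorted: "set (ord e n) = {1..n} \<and> sorted_wrt (\<lambda>b c. pless e (b, 0) (c, 0)) (ord e n)"
  unfolding ord_def
proof (induction "\<lambda>b. lab (vtx e b)" "\<lambda>b. w (vtx e b)" n rule: batch_order.induct)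
  case (3 n)
  let ?xs = "batch_order (\<lambda>b. lab (vtx e b)) (\<lambda>b. w (vtx e b)) (Suc n)"
  have "distinct ?xs" by (rule sorted_wrt_irrefl_distinct) (use 3 pless_irrefl in auto)
  then have "sorted_wrt (\<lambda>b c. pless e (b, 0) (c, 0))
      (batch_order (\<lambda>b. lab (vtx e b)) (\<lambda>b. w (vtx e b)) (Suc (Suc n)))"
    using ord_Suc_Suc[of ?xs n e] 3 unfolding batch_order.simps Let_def by simp
  moreover have "set (take t ?xs @ [Suc (Suc n)] @ drop t ?xs) = {1..Suc (Suc n)}" for t
  proof -
    have "set (take t ?xs) \<union> set (drop t ?xs) = {1..Suc n}"
      using 3 by (metis append_take_drop_id set_append)
    then show ?thesis by auto
  qed
  ultimately show ?case unfolding batch_order.simps Let_def by blast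
qed auto

section \<open>The points in both orders and the permutations \<open>prm n\<close>\<close>

definition mult :: "nat \<Rightarrow> nat \<Rightarrow> nat" where
  "mult n b = (if b = 1 \<or> b = n then 2 else 1)"

text \<open>Copy 0 lies toward the yearn, so it comes first in lines yearning backward. The two
  directions together turn a doubled batch into the identity block if its yearns agree as flags
  \<open>w\<close>, and into the exchange block otherwise.\<close>

definition blk :: "bool \<Rightarrow> nat \<Rightarrow> nat \<Rightarrow> (nat \<times> nat) list" where
  "blk e n b = map (\<lambda>u. (b, if w (vtx e b) then u else mult n b - 1 - u)) [0..<mult n b]"

definition plist :: "bool \<Rightarrow> nat \<Rightarrow> (nat \<times> nat) list" where
  "plist e n = concat (map (blk e n) (ord e n))"

lemma blk_eq: "blk e n b = (if b = 1 \<or> b = n then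
    if w (vtx e b) then [(b, 0), (b, 1)] else [(b, 1), (b, 0)] else [(b, 0)])"
  by (simp add: blk_def mult_def numeral_2_eq_2)

lemma set_plist: "set (plist e n) = pts n"
proof -
  have "set (blk e n b) = {b} \<times> {..<mult n b}" for b
    by (auto simp: blk_eq mult_def less_Suc_eq numeral_2_eq_2)
  then have "set (plist e n) = (\<Union>b\<in>{1..n}. {b} \<times> {..<mult n b})"
    using ord_sorted[of e n] by (simp add: plist_def)
  also have "\<dots> = pts n" by (auto simp: pts_def mult_def less_Suc_eq_le numeral_2_eq_2)
  finally show ?thesis .
qed

lemma plist_sorted: "sorted_wrt (pless e) (plist e n)"
  unfolding plist_def
proof (rule sorted_wrt_concat_map)
  show "sorted_wrt (\<lambda>b c. pless e (b, 0) (c, 0)) (ord e n)" using ord_sorted by blast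
  show "sorted_wrt (pless e) (blk e n b)" for b
    by (simp add: blk_eq pless_def pl_def key_def)
  show "pless e x y" if "pless e (b, 0) (c, 0)" "x \<in> set (blk e n b)" "y \<in> set (blk e n c)" for b c x y
  proof -
    have "fst x = b" "fst y = c" using that by (auto simp: blk_def)
    then show ?thesis
      using that(1)[unfolded pless_0] rnk_less_imp_key_less[of e x y] rnk_less_imp_key_less[of e y x]
      by (auto simp: pless_def pl_def split: if_splits)
  qed
qed

lemma plist_distinct: "distinct (plist e n)"
  using sorted_wrt_irrefl_distinct[OF plist_sorted] pless_irrefl by blast

lemma pless_iff_idx:
  assumes "x \<in> pts n" "y \<in> pts n"
  shows "pless e x y \<longleftrightarrow> idx (plist e n) x < idx (plist e n) y"
proof (rule sorted_wrt_less_iff_idx[OF plist_sorted plist_distinct])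
  show "\<not> pless e y x" if "x \<in> set (plist e n)" "y \<in> set (plist e n)" "pless e x y" for x y
    using that(1,2)[unfolded set_plist, THEN ptsD] pless_asym[OF _ _ that(3)] by simp
qed (simp_all add: assms set_plist)

lemma length_plist: "2 \<le> n \<Longrightarrow> length (plist e n) = n + 2"
proof -
  assume n: "2 \<le> n"
  have "length (plist e n) = card (pts n)" using distinct_card[OF plist_distinct] set_plist by metis
  also have "pts n = (\<lambda>b. (b, 0)) ` {1..n} \<union> {(1, 1), (n, 1)}"
    using n by (auto simp: pts_def image_iff le_Suc_eq split: if_splits)
  also have "card \<dots> = card ((\<lambda>b. (b, 0::nat)) ` {1..n}) + card {(1, 1::nat), (n, 1)}"
    by (rule card_Un_disjoint) auto
  also have "\<dots> = n + 2" using n by (simp add: card_image inj_on_def)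
  finally show ?thesis .
qed

definition prm :: "nat \<Rightarrow> nat list" where
  "prm n = perm_of (plist False n) (plist True n)"

lemma is_perm_prm: "is_perm (prm n)"
  unfolding prm_def by (rule is_perm_perm_of) (simp_all add: plist_distinct set_plist)

lemma length_prm: "2 \<le> n \<Longrightarrow> length (prm n) = n + 2"
  by (simp add: prm_def perm_of_def length_plist)

lemma prm_nth: "x < length (prm n) \<Longrightarrow> prm n ! x = idx (plist True n) (plist False n ! x)"
  by (simp add: prm_def perm_of_def)

lemma prm_pts: "x < length (prm n) \<Longrightarrow> plist False n ! x \<in> pts n"
  using set_plist[of False n] nth_mem[of x "plist False n"] by (simp add: prm_def perm_of_def)

lemma prm_pless:
  assumes "x < length (prm n)" "y < length (prm n)"
  shows "pless False (plist False n ! x) (plist False n ! y) \<longleftrightarrow> x < y"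
    and "pless True (plist False n ! x) (plist False n ! y) \<longleftrightarrow> prm n ! x < prm n ! y"
proof -
  have "x < length (plist False n)" "y < length (plist False n)"
    using assms by (auto simp: prm_def perm_of_def)
  then show "pless False (plist False n ! x) (plist False n ! y) \<longleftrightarrow> x < y"
    using pless_iff_idx[OF prm_pts[OF assms(1)] prm_pts[OF assms(2)], of False]
      idx_nth[OF plist_distinct] by simp
  show "pless True (plist False n ! x) (plist False n ! y) \<longleftrightarrow> prm n ! x < prm n ! y"
    using pless_iff_idx[OF prm_pts[OF assms(1)] prm_pts[OF assms(2)], of True] assms prm_nth by simp
qed

text \<open>The map \<open>h\<close> allows two lines of the cycle to lie in the same row or column of \<open>M\<close>, provided
  that the first one yearns backward and the second one forward.\<close>

lemma prm_profile:
  assumes h: "mono h"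
    and rlt: "\<And>k. odd k \<Longrightarrow> h (lab k) < dim_row M" and clt: "\<And>k. even k \<Longrightarrow> h (lab k) < dim_col M"
    and ent: "\<And>b. 1 \<le> b \<Longrightarrow> M $$ (h (lab (vtx False b)), h (lab (vtx True b)))
        = (if w (vtx False b) = w (vtx True b) then 1 else - 1)"
    and split: "\<And>j k. even j = even k \<Longrightarrow> lab j < lab k \<Longrightarrow> h (lab j) = h (lab k) \<Longrightarrow> w j \<and> \<not> w k"
  shows "prm n \<in> profile_class M"
proof -
  define rl where "rl x = h (pl False (plist False n ! x))" for x
  define cl where "cl y = h (pl True (plist True n ! y))" for y
  have "length (plist e n) = card (pts n)" for e
    using distinct_card[OF plist_distinct, of e n] by (simp add: set_plist)
  then have len: "length (plist e n) = length (prm n)" for e by (simp add: prm_def perm_of_def)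
  have mono: "h (pl e (plist e n ! x)) \<le> h (pl e (plist e n ! y))"
    if "x \<le> y" "y < length (prm n)" for x y e
  proof (cases "x = y")
    case False
    have "pless e (plist e n ! x) (plist e n ! y)"
      using sorted_wrt_nth_less[OF plist_sorted[of e n], of x y] that False by (auto simp: len)
    then show ?thesis using pless_pl_le h monoD by blast
  qed simp
  have pt: "1 \<le> fst (plist e n ! x) \<and> snd (plist e n ! x) \<le> 1" if "x < length (prm n)" for x e
    using ptsD[of "plist e n ! x" n] nth_mem[of x "plist e n"] that by (auto simp: len set_plist)
  have cl: "cl (prm n ! x) = h (pl True (plist False n ! x))" if "x < length (prm n)" for x
    using nth_idx[OF plist_distinct, of "plist False n ! x" True n] prm_pts[OF that] prm_nth[OF that] set_plist
    by (simp add: cl_def)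
  have entry: "M $$ (rl x, cl (prm n ! x)) = (if w (vtx False (fst (plist False n ! x)))
      = w (vtx True (fst (plist False n ! x))) then 1 else - 1)" if "x < length (prm n)" for x
    using ent pt[OF that] cl[OF that] by (simp add: rl_def pl_def)
  \<comment> \<open>Within one cell of \<open>M\<close> the sign decides the relative order of two
    points, even if they come from different lines of the cycle merged by \<open>h\<close>.\<close>
  have key: "pless True (plist False n ! x) (plist False n ! y) = (M $$ (rl x, cl (prm n ! x)) = 1)"
    if xy: "x < y" "y < length (prm n)" "rl x = rl y" "cl (prm n ! x) = cl (prm n ! y)" for x y
  proof -
    let ?x = "plist False n ! x" and ?y = "plist False n ! y"
    have R: "pless False ?x ?y" using prm_pless(1)[of x n y] xy by simp
    have b: "1 \<le> fst ?x" "1 \<le> fst ?y" "snd ?x \<le> 1" "snd ?y \<le> 1" using pt xy by auto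
    have x: "x < length (prm n)" using xy by simp
    have he: "h (pl e ?x) = h (pl e ?y)" for e
      using xy(3,4) cl[OF x] cl[OF xy(2)] by (cases e) (simp_all add: rl_def)
    have s: "(w (vtx False (fst ?x)) = w (vtx True (fst ?x))) = (w (vtx False (fst ?y)) = w (vtx True (fst ?y)))"
      using entry[OF x] entry[OF xy(2)] xy(3,4) by (auto split: if_splits)
    have sp: "w (vtx e (fst x)) \<and> \<not> w (vtx e (fst y))"
      if "pl e x < pl e y" "h (pl e x) = h (pl e y)" "1 \<le> fst x" "1 \<le> fst y" for e x y
      using split[of "vtx e (fst x)" "vtx e (fst y)"] that even_vtx by (auto simp: pl_def)
    show ?thesis
    proof (cases "\<forall>e. pl e ?x = pl e ?y")
      case True
      then have d: "int L dvd int (fst ?x) - int (fst ?y)" using cell_eq[OF b(1,2)] by (simp add: pl_def)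
      have "key True ?x \<noteq> key True ?y" using key_inj[OF b] R pless_irrefl by metis
      then show ?thesis using same_cell_pless[OF b d] R entry[OF x] by (auto split: if_splits)
    next
      case False
      \<comment> \<open>A common line has one yearn; the common sign makes the yearns in the other
        direction agree, and lines merged by \<open>h\<close> with equal yearns coincide.\<close>
      have ne: "pl e ?x \<noteq> pl e ?y" for e
      proof
        assume eq: "pl e ?x = pl e ?y"
        then have "w (vtx e (fst ?x)) = w (vtx e (fst ?y))" using w_pl b by blast
        then have "w (vtx e' (fst ?x)) = w (vtx e' (fst ?y))" for e' using s by (cases e; cases e') auto
        then have "pl e' ?x = pl e' ?y" for e'
          using sp[of e' ?x ?y] sp[of e' ?y ?x] he[of e'] b by (metis linorder_neqE_nat)
        then show False using False by blast
      qed
      \<comment> \<open>Now both lines differ. The row line of \<open>?x\<close> comes first, so it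
        yearns for the top; the sign then tells whether its column line yearns left and hence comes
        first as well.\<close>
      have "pl False ?x < pl False ?y" using R ne[of False] by (auto simp: pless_def)
      then have wr: "w (vtx False (fst ?x)) \<and> \<not> w (vtx False (fst ?y))" using sp he b by blast
      show ?thesis
      proof (cases "pl True ?x < pl True ?y")
        case True
        then have "w (vtx True (fst ?x))" using sp he b by blast
        then show ?thesis using entry[OF x] wr True by (auto simp: pless_def)
      next
        case F: False
        then have gt: "pl True ?y < pl True ?x" using ne[of True] by auto
        then have "\<not> w (vtx True (fst ?x))" using sp[of True ?y ?x] he[of True] b by auto
        then show ?thesis using entry[OF x] wr gt by (auto simp: pless_def)
      qed
    qed
  qed
  show ?thesis
  proof (rule profile_classI[of _ rl cl])
    show "is_perm (prm n)" by (rule is_perm_prm)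
    show "rl x \<le> rl y" "cl x \<le> cl y" if "x \<le> y" "y < length (prm n)" for x y
      using mono[OF that] by (auto simp: rl_def cl_def)
    show "rl x < dim_row M" "cl x < dim_col M" if "x < length (prm n)" for x
      using rlt[of "vtx False (fst (plist False n ! x))"] clt[of "vtx True (fst (plist True n ! x))"]
        even_vtx pt[OF that] by (auto simp: rl_def cl_def pl_def)
    show "M $$ (rl x, cl (prm n ! x)) \<noteq> 0" if "x < length (prm n)" for x
      using entry[OF that] by simp
    fix x y assume xy: "x < y" "y < length (prm n)" "rl x = rl y" "cl (prm n ! x) = cl (prm n ! y)"
    then have lt: "prm n ! x < prm n ! y \<longleftrightarrow> M $$ (rl x, cl (prm n ! x)) = 1"
      using key[OF xy] prm_pless(2)[of x n y] by simp
    then show "M $$ (rl x, cl (prm n ! x)) = 1 \<Longrightarrow> prm n ! x < prm n ! y" by simp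
    have "distinct (prm n)" using is_perm_prm by (simp add: is_perm_def permutations_of_set_def)
    then have "prm n ! x \<noteq> prm n ! y" using xy nth_eq_iff_index_eq by fastforce
    then show "M $$ (rl x, cl (prm n ! x)) = - 1 \<Longrightarrow> prm n ! y < prm n ! x" using lt by linarith
  qed
qed

end

section \<open>The antichain belonging to a cycle of lines\<close>

context line_cycle
begin

text \<open>A containment preserves the order of positions and of values, which are the two orders
  of the points, so it gives a \<open>line_embedding\<close>. Comparing lengths yields
  \<open>m < n\<close>.\<close>

lemma prm_not_pattern_le:
  assumes "(3 * L ^ L + 10) * L \<le> m" "(3 * L ^ L + 10) * L \<le> n" "m \<noteq> n"
  shows "\<not> pattern_le (prm m) (prm n)"
proof
  assume "pattern_le (prm m) (prm n)"
  then obtain f where f: "strict_mono_on {..<length (prm m)} f" "f ` {..<length (prm m)} \<subseteq> {..<length (prm n)}"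
    "\<And>a b. a < length (prm m) \<Longrightarrow> b < length (prm m) \<Longrightarrow> prm m ! a < prm m ! b \<longleftrightarrow> prm n ! f a < prm n ! f b"
    unfolding pattern_le_def by blast
  have "L * 10 \<le> m" "L * 10 \<le> n" using assms(1,2) by (auto simp: algebra_simps)
  then have big: "2 \<le> m" "2 \<le> n" using L_ge by auto
  have "card {..<length (prm m)} \<le> card {..<length (prm n)}"
    using f(1,2) strict_mono_on_imp_inj_on by (intro card_inj_on_le) auto
  then have mn: "m < n" using length_prm big assms(3) by simp
  have idx: "idx (plist False m) x < length (prm m)" "plist False m ! idx (plist False m) x = x"
    if "x \<in> pts m" for x
    using nth_idx[OF plist_distinct, of x False m] that by (auto simp: set_plist prm_def perm_of_def)
  define \<phi> where "\<phi> x = plist False n ! f (idx (plist False m) x)" for x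
  have fl: "f a < length (prm n)" if "a < length (prm m)" for a using f(2) that by blast
  interpret line_embedding L lab w m n \<phi>
  proof
    show "\<phi> x \<in> pts n" if "x \<in> pts m" for x
      unfolding \<phi>_def using prm_pts[OF fl[OF idx(1)[OF that]]] .
    show "pless e (\<phi> x) (\<phi> y)" if "x \<in> pts m" "y \<in> pts m" "pless e x y" for e x y
    proof -
      define a b where "a = idx (plist False m) x" and "b = idx (plist False m) y"
      have ab: "a < length (prm m)" "b < length (prm m)" "plist False m ! a = x" "plist False m ! b = y"
        using idx that by (auto simp: a_def b_def)
      show ?thesis
      proof (cases e)
        case True
        then have "prm m ! a < prm m ! b" using prm_pless(2)[OF ab(1,2)] ab(3,4) that(3) by simp
        then have "prm n ! f a < prm n ! f b" using f(3) ab by blast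
        then show ?thesis using prm_pless(2)[OF fl[OF ab(1)] fl[OF ab(2)]] True
          by (simp add: \<phi>_def a_def b_def)
      next
        case False
        then have "a < b" using prm_pless(1)[OF ab(1,2)] ab(3,4) that(3) by simp
        then have "f a < f b" using f(1) ab by (auto simp: strict_mono_on_def)
        then show ?thesis using prm_pless(1)[OF fl[OF ab(1)] fl[OF ab(2)]] False
          by (simp add: \<phi>_def a_def b_def)
      qed
    qed
  qed (use assms mn in auto)
  show False by (rule embedding_False)
qed

lemma prm_antichain:
  defines "N \<equiv> (3 * L ^ L + 10) * L"
  shows "infinite (prm ` {N..})" "antichain (prm ` {N..})"
proof -
  have "L * 10 \<le> N" by (auto simp: N_def algebra_simps)
  then have N: "2 \<le> N" using L_ge by linarith
  have "inj_on prm {N..}"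
  proof (rule inj_onI)
    fix m n assume "m \<in> {N..}" "n \<in> {N..}" "prm m = prm n"
    then show "m = n" using length_prm[of m] length_prm[of n] N by (metis add_right_cancel atLeast_iff order_trans)
  qed
  then show "infinite (prm ` {N..})" using finite_imageD infinite_Ici by blast
  show "antichain (prm ` {N..})"
    unfolding antichain_def pairwise_def
    using prm_not_pattern_le by (auto simp: N_def)
qed

end

section \<open>Cycles of a matrix\<close>

text \<open>The cycle is unrolled into a sequence of period \<open>L\<close> that starts with a
  prescribed edge in a prescribed direction.\<close>

lemma cycle_graph_seq:
  assumes "cycle_graph V E" "{a, b} \<in> E"
  shows "\<exists>L v. 3 \<le> L \<and> v 0 = a \<and> v 1 = b \<and> (\<forall>j k. v j = v k \<longleftrightarrow> int L dvd int j - int k) \<and>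
    range v = V \<and> E = {{v k, v (Suc k)} | k. True}"
proof -
  obtain vs where vs: "3 \<le> length vs" "distinct vs" "V = set vs"
    "E = {{vs ! i, vs ! (Suc i mod length vs)} | i. i < length vs}"
    using assms(1) unfolding cycle_graph_def by blast
  define L where "L = length vs"
  have L0: "0 < int L" using vs(1) L_def by linarith
  \<comment> \<open>Integer indices let the walk run backward, as needed if the edge from
    \<open>a\<close> to \<open>b\<close> is directed against \<open>vs\<close>.\<close>
  define u where "u i = vs ! nat (i mod int L)" for i :: int
  have nL: "nat (i mod int L) < L" for i using L0 by (simp add: nat_less_iff)
  have ueq: "u i = u j \<longleftrightarrow> int L dvd i - j" for i j
  proof -
    have "u i = u j \<longleftrightarrow> nat (i mod int L) = nat (j mod int L)"
      unfolding u_def using nth_eq_iff_index_eq[OF vs(2)] nL L_def by simp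
    also have "\<dots> \<longleftrightarrow> i mod int L = j mod int L" using L0 by (simp add: eq_nat_nat_iff)
    finally show ?thesis by (simp add: mod_eq_dvd_iff)
  qed
  have un: "u (int i) = vs ! (i mod L)" for i by (simp add: u_def nat_mod_distrib)
  have ru: "range u = V"
  proof
    show "range u \<subseteq> V" using nL nth_mem unfolding u_def vs(3) L_def by blast
    show "V \<subseteq> range u" unfolding vs(3)
      using un L_def by (metis in_set_conv_nth mod_less rangeI subsetI)
  qed
  have Eu: "E = {{u i, u (i + 1)} | i. True}"
  proof
    show "E \<subseteq> {{u i, u (i + 1)} | i. True}"
    proof
      fix x assume "x \<in> E"
      then obtain i where "i < L" "x = {vs ! i, vs ! (Suc i mod L)}" using vs(4) L_def by auto
      then have "x = {u (int i), u (int i + 1)}" using un[of i] un[of "Suc i"] by (simp add: add.commute)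
      then show "x \<in> {{u i, u (i + 1)} | i. True}" by blast
    qed
    show "{{u i, u (i + 1)} | i. True} \<subseteq> E"
    proof
      fix x assume "x \<in> {{u i, u (i + 1)} | i. True}"
      then obtain i where x: "x = {u i, u (i + 1)}" by blast
      define k where "k = nat (i mod int L)"
      have k: "k < L" "int k = i mod int L" using nL L0 by (auto simp: k_def)
      have "u i = u (int k)" "u (i + 1) = u (int (Suc k))"
        using ueq k(2) by (auto simp: algebra_simps)
      then have "x = {vs ! k, vs ! (Suc k mod L)}" using x un[of k] un[of "Suc k"] k(1) by simp
      then show "x \<in> E" using vs(4) k(1) L_def by blast
    qed
  qed
  have cng: "\<exists>k::nat. u i = u (c + int k) \<and> u (i + 1) = u (c + int (Suc k))" for i c
  proof -
    define k where "k = nat ((i - c) mod int L)"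
    have k: "int k = (i - c) mod int L" using L0 by (simp add: k_def)
    have "int L dvd (i - c) - int k" unfolding k by (rule dvd_minus_mod)
    then show ?thesis using ueq by (intro exI[of _ k]) (auto simp: algebra_simps)
  qed
  have cng': "\<exists>k::nat. u (i + 1) = u (c - int k) \<and> u i = u (c - int (Suc k))" for i c
  proof -
    define k where "k = nat ((c - i - 1) mod int L)"
    have k: "int k = (c - i - 1) mod int L" using L0 by (simp add: k_def)
    have "int L dvd (c - i - 1) - int k" unfolding k by (rule dvd_minus_mod)
    then have "int L dvd int k - (c - i - 1)" by (simp add: dvd_diff_commute)
    then show ?thesis using ueq by (intro exI[of _ k]) (auto simp: algebra_simps)
  qed
  obtain c where "{a, b} = {u c, u (c + 1)}" using assms(2) Eu by blast
  then consider "a = u c" "b = u (c + 1)" | "a = u (c + 1)" "b = u c" by (auto simp: doubleton_eq_iff)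
  then show ?thesis
  proof cases
    case 1
    define v where "v k = u (c + int k)" for k
    have veq: "v j = v k \<longleftrightarrow> int L dvd int j - int k" for j k by (simp add: v_def ueq)
    have vk: "\<exists>k. u i = v k \<and> u (i + 1) = v (Suc k)" for i
      unfolding v_def by (rule cng)
    have "range v = V"
    proof
      show "range v \<subseteq> V" by (auto simp: v_def simp flip: ru)
      show "V \<subseteq> range v" unfolding ru[symmetric] using vk by (metis image_subsetI rangeI)
    qed
    moreover have "E = {{v k, v (Suc k)} | k. True}"
    proof
      show "E \<subseteq> {{v k, v (Suc k)} | k. True}"
      proof
        fix x assume "x \<in> E"
        then obtain i where x: "x = {u i, u (i + 1)}" using Eu by blast
        from vk[of i] obtain k where "u i = v k \<and> u (i + 1) = v (Suc k)" ..
        then have "x = {v k, v (Suc k)}" using x by simp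
        then show "x \<in> {{v k, v (Suc k)} | k. True}" by blast
      qed
      have "{v k, v (Suc k)} = {u (c + int k), u (c + int k + 1)}" for k
        by (simp add: v_def algebra_simps)
      then show "{{v k, v (Suc k)} | k. True} \<subseteq> E" unfolding Eu by blast
    qed
    moreover have "3 \<le> L" "v 0 = a" "v 1 = b" using 1 vs(1) by (auto simp: v_def L_def)
    ultimately show ?thesis using veq by (intro exI[of _ L] exI[of _ v]) blast
  next
    case 2
    define v where "v k = u (c + 1 - int k)" for k
    have veq: "v j = v k \<longleftrightarrow> int L dvd int j - int k" for j k by (simp add: v_def ueq dvd_diff_commute)
    have vk: "\<exists>k. u (i + 1) = v k \<and> u i = v (Suc k)" for i
      unfolding v_def by (rule cng')
    have "range v = V"
    proof
      show "range v \<subseteq> V" by (auto simp: v_def simp flip: ru)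
      show "V \<subseteq> range v" unfolding ru[symmetric] using vk by (metis image_subsetI rangeI)
    qed
    moreover have "E = {{v k, v (Suc k)} | k. True}"
    proof
      show "E \<subseteq> {{v k, v (Suc k)} | k. True}"
      proof
        fix x assume "x \<in> E"
        then obtain i where x: "x = {u i, u (i + 1)}" using Eu by blast
        from vk[of i] obtain k where "u (i + 1) = v k \<and> u i = v (Suc k)" ..
        then have "x = {v k, v (Suc k)}" using x by (simp add: insert_commute)
        then show "x \<in> {{v k, v (Suc k)} | k. True}" by blast
      qed
      have "{v k, v (Suc k)} = {u (c - int k), u (c - int k + 1)}" for k
        by (auto simp: v_def algebra_simps)
      then show "{{v k, v (Suc k)} | k. True} \<subseteq> E" unfolding Eu by blast
    qed
    moreover have "3 \<le> L" "v 0 = a" "v 1 = b" using 2 vs(1) by (auto simp: v_def L_def)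
    ultimately show ?thesis using veq by (intro exI[of _ L] exI[of _ v]) blast
  qed
qed

section \<open>Yearns along a cycle of a matrix\<close>

lemma periodic_dvd:
  fixes g :: "nat \<Rightarrow> 'a"
  assumes "\<And>k. g (k + L) = g k" "int L dvd int j - int k"
  shows "g j = g k"
proof -
  have st: "g (k + t * L) = g k" for k t
  proof (induction t)
    case (Suc t)
    then show ?case using assms(1)[of "k + t * L"] by (simp add: algebra_simps)
  qed simp
  have le: "g j = g k" if "k \<le> j" "int L dvd int j - int k" for j k
  proof -
    have "int L dvd int (j - k)" using that by (simp add: of_nat_diff)
    then have "L dvd j - k" by (simp only: of_nat_dvd_iff)
    then obtain t where "j - k = L * t" ..
    then show ?thesis using st[of k t] that(1) by (metis le_add_diff_inverse mult.commute)
  qed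
  show ?thesis using le[of k j] le[of j k] assms(2) by (cases "k \<le> j") (auto simp: dvd_diff_commute)
qed

text \<open>\<open>ln k\<close> is the column (even \<open>k\<close>) or row (odd \<open>k\<close>)
  of \<open>M\<close> at vertex \<open>k\<close>. The cycle may be a proper part of the graph, so
  \<open>M\<close> may have further nonzero entries.\<close>

locale matrix_cycle =
  fixes M :: "int mat" and L :: nat and ln :: "nat \<Rightarrow> nat"
  assumes L_even: "even L" and L_ge: "4 \<le> L"
    and ln_eq: "even j = even k \<Longrightarrow> ln j = ln k \<longleftrightarrow> int L dvd int j - int k"
    and ln_row: "odd k \<Longrightarrow> ln k < dim_row M" and ln_col: "even k \<Longrightarrow> ln k < dim_col M"
    and entry: "1 \<le> b \<Longrightarrow> M $$ (ln (vtx False b), ln (vtx True b)) \<in> {1, -1}"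
begin

definition cell :: "nat \<Rightarrow> nat \<times> nat" where
  "cell b = (ln (vtx False b), ln (vtx True b))"

text \<open>The start value is the yearn of batch 1, which is to the right for both signs.\<close>

primrec wv :: "nat \<Rightarrow> bool" where
  "wv 0 = False"
| "wv (Suc k) = (wv k = (M $$ cell (Suc k) = 1))"

text \<open>Constant yearns are periodic for all signs, so the facts on cells become available
  before it is known whether \<open>wv\<close> is periodic.\<close>

sublocale trivial: line_cycle L ln "\<lambda>_. True"
  by unfold_locales (use L_even L_ge ln_eq in auto)

lemma cell_eq: "1 \<le> b \<Longrightarrow> 1 \<le> c \<Longrightarrow> cell b = cell c \<longleftrightarrow> int L dvd int b - int c"
  using trivial.cell_eq[of b c] by (auto simp: cell_def all_bool_eq)

lemma entry_wv: "1 \<le> b \<Longrightarrow> M $$ cell b = (if wv (vtx False b) = wv (vtx True b) then 1 else -1)"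
proof -
  assume b: "1 \<le> b"
  then obtain k where k: "b = Suc k" by (cases b) auto
  have "M $$ cell b = 1 \<longleftrightarrow> wv k = wv (Suc k)" by (auto simp: k)
  moreover have "wv k = wv (Suc k) \<longleftrightarrow> wv (vtx False b) = wv (vtx True b)"
    by (auto simp: vtx_def k simp del: wv.simps)
  moreover have "M $$ cell b \<in> {1, -1}" using entry[OF b] by (simp add: cell_def)
  ultimately show ?thesis by auto
qed

text \<open>The cells, hence the signs, repeat after a round, so a round flips either all yearns or
  none.\<close>

lemma wv_add_L: "wv (k + L) = (wv k = (wv L = wv 0))"
proof (induction k)
  case (Suc k)
  have "cell (Suc (k + L)) = cell (Suc k)" using cell_eq by simp
  then show ?case using Suc by auto
qed auto

lemma wv_odd: "wv k \<longleftrightarrow> odd (card {b \<in> {1..k}. M $$ cell b = -1})"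
proof (induction k)
  case (Suc k)
  have *: "{b \<in> {1..Suc k}. M $$ cell b = -1} = {b \<in> {1..k}. M $$ cell b = -1} \<union>
      (if M $$ cell (Suc k) = -1 then {Suc k} else {})" by (auto simp: le_Suc_eq)
  have "M $$ cell (Suc k) \<in> {1, -1}" using entry[of "Suc k"] by (simp add: cell_def)
  then show ?case using Suc unfolding * by auto
qed simp

lemma line_cycle_even:
  assumes "wv L = wv 0"
  shows "line_cycle L ln wv"
proof
  show "wv j = wv k" if "int L dvd int j - int k" for j k
    using periodic_dvd[of wv L j k] wv_add_L assms that by simp
qed (use L_even L_ge ln_eq in auto)

text \<open>Each line is split into two halves, the one yearning backward first. A cell of sign 1
  joins halves of equal yearn, a cell of sign -1 halves of opposite yearn: these are the identity
  and exchange blocks of the refined matrix.\<close>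

definition lab2 :: "nat \<Rightarrow> nat" where
  "lab2 k = 2 * ln k + (if wv k then 0 else 1)"

lemma lab2_eq: "lab2 j = lab2 k \<longleftrightarrow> ln j = ln k \<and> wv j = wv k"
proof -
  have "2 * a + (if p then 0 else 1) = 2 * b + (if q then 0 else 1) \<longleftrightarrow> a = b \<and> p = q"
    for a b :: nat and p q by (cases p; cases q; simp; presburger)
  then show ?thesis unfolding lab2_def .
qed

text \<open>Yearns change after \<open>L\<close> steps, so two vertices on the same half of a line
  differ by an even multiple of \<open>L\<close>.\<close>

lemma line_cycle_odd:
  assumes "wv L \<noteq> wv 0"
  shows "line_cycle (2 * L) lab2 wv"
proof
  have neg: "wv (k + L) = (\<not> wv k)" for k using wv_add_L assms by auto
  have per: "wv (k + 2 * L) = wv k" for k using neg[of "k + L"] neg[of k] by (simp add: mult_2 add.assoc)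
  then show w2: "wv j = wv k" if "int (2 * L) dvd int j - int k" for j k
    using periodic_dvd that by blast
  show "even (2 * L)" "4 \<le> 2 * L" using L_ge by auto
  fix j k :: nat assume p: "even j = even k"
  show "lab2 j = lab2 k \<longleftrightarrow> int (2 * L) dvd int j - int k"
  proof
    assume "lab2 j = lab2 k"
    then have d: "int L dvd int j - int k" and w: "wv j = wv k" using ln_eq p lab2_eq by auto
    obtain t where t: "int j - int k = int L * t" using d by (elim dvdE)
    show "int (2 * L) dvd int j - int k"
    proof (cases "even t")
      case True
      then show ?thesis unfolding t by (auto elim!: evenE)
    next
      case False
      then obtain s where s: "t = 2 * s + 1" by (elim oddE)
      have "int (j + L) - int k = int (2 * L) * (s + 1)" using t by (simp add: s algebra_simps)
      then have "wv (j + L) = wv k" using w2 dvd_triv_left by metis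
      then show ?thesis using neg w by auto
    qed
  next
    assume d: "int (2 * L) dvd int j - int k"
    then have "int L dvd int j - int k" by (metis dvd_mult_right of_nat_mult)
    then show "lab2 j = lab2 k" using ln_eq[OF p] w2[OF d] lab2_eq by auto
  qed
qed

lemma profile_even:
  assumes "wv L = wv 0"
  shows "line_cycle.prm ln wv n \<in> profile_class M"
proof -
  interpret line_cycle L ln wv by (rule line_cycle_even[OF assms])
  show ?thesis
    by (rule prm_profile[where h = "\<lambda>x. x"])
      (use ln_row ln_col entry_wv in \<open>auto simp: mono_def cell_def\<close>)
qed

text \<open>Division by 2 merges the two halves of a line again, and their yearns are as
  \<open>prm_profile\<close> demands.\<close>

lemma profile_odd:
  assumes "wv L \<noteq> wv 0"
  shows "line_cycle.prm lab2 wv n \<in> profile_class M"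
proof -
  interpret line_cycle "2 * L" lab2 wv by (rule line_cycle_odd[OF assms])
  have half: "lab2 k div 2 = ln k" for k by (simp add: lab2_def)
  show ?thesis
  proof (rule prm_profile[where h = "\<lambda>x. x div 2"])
    show "mono (\<lambda>x::nat. x div 2)" by (simp add: mono_def div_le_mono)
    show "wv j \<and> \<not> wv k" if "lab2 j < lab2 k" "lab2 j div 2 = lab2 k div 2" for j k
      using that by (auto simp: half) (auto simp: lab2_def split: if_splits)
  qed (use ln_row ln_col entry_wv in \<open>auto simp: half cell_def\<close>)
qed

lemma ex_infinite_antichain: "\<exists>A \<subseteq> profile_class M. infinite A \<and> antichain A"
proof (cases "wv L = wv 0")
  case True
  interpret line_cycle L ln wv by (rule line_cycle_even[OF True])
  show ?thesis using prm_antichain profile_even[OF True] by (meson image_subsetI)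
next
  case False
  interpret line_cycle "2 * L" lab2 wv by (rule line_cycle_odd[OF False])
  show ?thesis using prm_antichain profile_odd[OF False] by (meson image_subsetI)
qed

end

text \<open>The walk starts in column \<open>j0\<close> and passes to row \<open>i0\<close>; with
  the cell of batch 1 as first edge, it then follows the batch construction.\<close>

lemma matrix_cycle_of_graph:
  assumes el: "elements_mat M \<subseteq> {0, 1, -1}" and c: "cycle_graph V E" and sub: "E \<subseteq> graph_edges M"
    and e: "{Inr j0, Inl i0} \<in> E"
  shows "\<exists>L ln. matrix_cycle M L ln \<and> ln 0 = j0 \<and> ln 1 = i0 \<and>
    E = {{Inl (ln (vtx False b)), Inr (ln (vtx True b))} | b. 1 \<le> b}"
proof -
  obtain L v where v: "3 \<le> L" "v 0 = Inr j0" "v 1 = Inl i0" "\<And>j k. v j = v k \<longleftrightarrow> int L dvd int j - int k"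
    "E = {{v k, v (Suc k)} | k. True}"
    using cycle_graph_seq[OF c e] by auto
  define ln where "ln k = (case v k of Inl i \<Rightarrow> i | Inr j \<Rightarrow> j)" for k
  have ed: "{v k, v (Suc k)} \<in> graph_edges M" for k using v(5) sub by blast
  \<comment> \<open>Every edge joins a row and a column, so the kinds alternate, starting with a
    column. This makes \<open>L\<close> even.\<close>
  have vv: "v k = (if even k then Inr (ln k) else Inl (ln k))" for k
  proof (induction k)
    case 0
    show ?case using v(2) by (simp add: ln_def)
  next
    case (Suc k)
    obtain i j where ij: "{v k, v (Suc k)} = {Inl i, Inr j}" using ed[of k] by (auto simp: graph_edges_def)
    then show ?case using Suc by (auto simp: doubleton_eq_iff ln_def split: if_splits)
  qed
  have eb: "{v k, v (Suc k)} = {Inl (ln (vtx False (Suc k))), Inr (ln (vtx True (Suc k)))}" for k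
    using vv[of k] vv[of "Suc k"] by (auto simp: vtx_def)
  have sup: "(ln (vtx False (Suc k)), ln (vtx True (Suc k))) \<in> supp M" for k
    using ed[of k] unfolding eb graph_edges_def by (auto simp: doubleton_eq_iff)
  have "v L = v 0" using v(4) by simp
  then have Le: "even L" using vv[of L] v(2) by (auto split: if_splits)
  have "matrix_cycle M L ln"
  proof
    show "even L" by fact
    show "4 \<le> L" using v(1) Le by presburger
    show "ln j = ln k \<longleftrightarrow> int L dvd int j - int k" if "even j = even k" for j k
      using v(4)[of j k] vv[of j] vv[of k] that by auto
    show "ln k < dim_row M" if "odd k" for k
      using sup[of "k - 1"] that by (cases k) (auto simp: supp_def vtx_def)
    show "ln k < dim_col M" if "even k" for k
      using sup[of k] that by (auto simp: supp_def vtx_def)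
    show "M $$ (ln (vtx False b), ln (vtx True b)) \<in> {1, -1}" if "1 \<le> b" for b
    proof -
      have s: "(ln (vtx False b), ln (vtx True b)) \<in> supp M" using sup[of "b - 1"] that by simp
      then have "M $$ (ln (vtx False b), ln (vtx True b)) \<in> elements_mat M"
        by (force simp: supp_def elements_mat_def)
      then show ?thesis using el s by (auto simp: supp_def)
    qed
  qed
  moreover have "ln 0 = j0" "ln 1 = i0" using v(2,3) by (auto simp: ln_def)
  moreover have "E = {{Inl (ln (vtx False b)), Inr (ln (vtx True b))} | b. 1 \<le> b}"
  proof -
    have "E = {{Inl (ln (vtx False (Suc k))), Inr (ln (vtx True (Suc k)))} | k. True}"
      unfolding v(5) eb ..
    also have "\<dots> = {{Inl (ln (vtx False b)), Inr (ln (vtx True b))} | b. 1 \<le> b}"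
      by (metis (no_types, lifting) One_nat_def Suc_le_D le_SucI zero_le Suc_le_mono)
    finally show ?thesis .
  qed
  ultimately show ?thesis by blast
qed

section \<open>The batch construction\<close>

lemma set_batch_order: "set (batch_order line bk n) \<subseteq> {1..n}"
proof (induction line bk n rule: batch_order.induct)
  case (3 line bk n)
  then show ?case
    by (auto simp: Let_def dest!: in_set_takeD in_set_dropD)
qed auto

text \<open>Cells and yearns are meaningful only from batch 1 on, so agreement from there must
  suffice to compare the orders.\<close>

lemma batch_order_cong:
  assumes "\<And>k. 1 \<le> k \<Longrightarrow> k \<le> n \<Longrightarrow> line k = line' k \<and> bk k = bk' k"
  shows "batch_order line bk n = batch_order line' bk' n"
  using assms
proof (induction line bk n rule: batch_order.induct)
  case (3 line bk n)
  let ?xs = "batch_order line bk (Suc n)" and ?b = "Suc (Suc n)"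
  have IH: "?xs = batch_order line' bk' (Suc n)" using 3 by simp
  have eq: "line k = line' k" if "k \<in> set ?xs" for k
    using 3(2)[of k] set_batch_order[of line bk "Suc n"] that by auto
  have "line ?b = line' ?b" "bk ?b = bk' ?b" "line (?b - 1) = line' (?b - 1)"
    using 3(2)[of ?b] 3(2)[of "?b - 1"] by auto
  then have "batch_slots line bk ?xs ?b = batch_slots line' bk' ?xs ?b" "bk ?b = bk' ?b"
    unfolding batch_slots_def using eq by auto
  then show ?case unfolding batch_order.simps Let_def IH[symmetric] by simp
qed auto

text \<open>The cycle is now the whole graph, numbered from the column and the row of the first
  batch.\<close>

locale full_matrix_cycle = matrix_cycle +
  assumes supp_eq: "supp M = cell ` {1..}"
    and ln_1: "ln 1 = 0" and ln_0: "ln 0 = (LEAST j. (0, j) \<in> supp M)"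
begin

lemma not_dvd_small: "0 < x \<Longrightarrow> x < 4 \<Longrightarrow> \<not> int L dvd x"
  using dvd_abs_less_imp_0[of "int L" x] L_ge by auto

text \<open>\<open>rnk e b\<close> is also the number of the neighbour with which batch
  \<open>b\<close> shares its line in direction \<open>e\<close>, and each line of the cycle has
  just two cells.\<close>

lemma shared_line:
  assumes "1 \<le> b" "1 \<le> c" "ln (vtx e c) = ln (vtx e b)"
  shows "int L dvd int c - int b \<or> int L dvd int c - int (rnk e b)"
proof -
  have d: "int L dvd int (vtx e c) - int (vtx e b)" using ln_eq assms even_vtx by metis
  show ?thesis
  proof (cases "even b = even c")
    case True
    then have "int (vtx e c) - int (vtx e b) = int c - int b" using assms(1,2) by (auto simp: vtx_def)
    then show ?thesis using d by simp
  next
    case False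
    then have "int (vtx e c) - int (vtx e b) = int c - int (rnk e b)"
      using assms(1,2) by (auto simp: vtx_def rnk_def)
    then show ?thesis using d by simp
  qed
qed

lemma cell_1: "cell 1 = (0, LEAST j. (0, j) \<in> supp M)"
  using ln_0 ln_1 by (simp add: cell_def vtx_def)

text \<open>Each line offers two cells, so a walk that does not turn back is forced;
  \<open>4 \<le> L\<close> keeps three consecutive cells distinct.\<close>

lemma batch_cell_eq: "1 \<le> b \<Longrightarrow> batch_cell M b = cell b"
proof (induction b rule: less_induct)
  case (less b)
  consider "b = 1" | "b = 2" | n where "b = Suc (Suc (Suc n))"
    using less.prems by (metis One_nat_def Suc_1 not0_implies_Suc not_one_le_zero)
  then show ?case
  proof cases
    case 1
    then show ?thesis using cell_1 by simp
  next
    case 2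
    have e1: "batch_cell M (Suc 0) = cell 1" using cell_1 by simp
    have "(THE e. e \<in> supp M \<and> fst e = fst (cell 1) \<and> e \<noteq> cell 1) = cell 2"
    proof (rule the_equality)
      have "cell 2 \<noteq> cell 1" using cell_eq[of 2 1] not_dvd_small[of 1] by simp
      moreover have "fst (cell 2) = fst (cell 1)" by (simp add: cell_def vtx_def)
      moreover have "cell 2 \<in> supp M" using supp_eq by simp
      ultimately show "cell 2 \<in> supp M \<and> fst (cell 2) = fst (cell 1) \<and> cell 2 \<noteq> cell 1" by blast
    next
      fix e assume e: "e \<in> supp M \<and> fst e = fst (cell 1) \<and> e \<noteq> cell 1"
      then obtain c where c: "e = cell c" "1 \<le> c" using supp_eq by auto
      have "int L dvd int c - int 1 \<or> int L dvd int c - int (rnk False 1)"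
        using shared_line[of 1 c False] e c by (simp add: cell_def)
      then have "int L dvd int c - int 2" using cell_eq[of c 1] c e by (auto simp: rnk_def)
      then show "e = cell 2" using cell_eq[of c 2] c by simp
    qed
    then show ?thesis using e1 by (simp add: 2 numeral_2_eq_2)
  next
    case (3 n)
    let ?e' = "cell (Suc (Suc n))" and ?e'' = "cell (Suc n)"
    have IH: "batch_cell M (Suc (Suc n)) = ?e'" "batch_cell M (Suc n) = ?e''" using less.IH 3 by auto
    have "(THE e. e \<in> supp M \<and> (fst e = fst ?e' \<or> snd e = snd ?e') \<and> e \<noteq> ?e' \<and> e \<noteq> ?e'') = cell b"
    proof (rule the_equality)
      have "cell b \<noteq> ?e'" "cell b \<noteq> ?e''"
        using cell_eq[of b "Suc (Suc n)"] cell_eq[of b "Suc n"] not_dvd_small[of 1] not_dvd_small[of 2]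
        by (auto simp: 3)
      moreover have "fst (cell b) = fst ?e' \<or> snd (cell b) = snd ?e'"
        by (cases "even n") (auto simp: cell_def vtx_def 3)
      moreover have "cell b \<in> supp M" using supp_eq less.prems by simp
      ultimately show "cell b \<in> supp M \<and> (fst (cell b) = fst ?e' \<or> snd (cell b) = snd ?e')
          \<and> cell b \<noteq> ?e' \<and> cell b \<noteq> ?e''" by blast
    next
      fix e assume e: "e \<in> supp M \<and> (fst e = fst ?e' \<or> snd e = snd ?e') \<and> e \<noteq> ?e' \<and> e \<noteq> ?e''"
      then obtain c where c: "e = cell c" "1 \<le> c" using supp_eq by auto
      obtain d where d: "ln (vtx d c) = ln (vtx d (Suc (Suc n)))"
        using e c by (auto simp: cell_def)
      have "\<not> int L dvd int c - int (Suc (Suc n))" "\<not> int L dvd int c - int (Suc n)"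
        using cell_eq[of c "Suc (Suc n)"] cell_eq[of c "Suc n"] c e by auto
      moreover have "rnk d (Suc (Suc n)) = Suc n \<or> rnk d (Suc (Suc n)) = b"
        by (auto simp: rnk_def 3)
      ultimately have "int L dvd int c - int b"
        using shared_line[OF _ c(2) d] by auto
      then show "e = cell b" using cell_eq[of c b] c less.prems by simp
    qed
    then show ?thesis using IH by (simp add: 3 Let_def)
  qed
qed

lemma batch_yearn_eq:
  "1 \<le> b \<Longrightarrow> batch_yearn M b =
     (if wv (vtx False b) then Top else Bottom, if wv (vtx True b) then Left else Right)"
proof (induction b)
  case (Suc b)
  show ?case
  proof (cases b)
    case 0
    have "M $$ cell (Suc 0) \<in> {1, -1}" using entry[of 1] by (simp add: cell_def)
    then show ?thesis using batch_cell_eq[of 1] by (auto simp: 0 vtx_def)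
  next
    case (Suc n)
    note IH = Suc.IH[unfolded Suc]
    have c: "batch_cell M (Suc (Suc n)) = cell (Suc (Suc n))" "batch_cell M (Suc n) = cell (Suc n)"
      using batch_cell_eq by auto
    have m: "M $$ cell (Suc (Suc n)) = 1 \<longleftrightarrow> wv (Suc n) = wv (Suc (Suc n))" by auto
    \<comment> \<open>Batches \<open>n + 1\<close> and \<open>n + 2\<close> share vertex
      \<open>n + 1\<close>, which is a row for even \<open>n\<close>.\<close>
    have sh: "fst (cell (Suc (Suc n))) = fst (cell (Suc n)) \<longleftrightarrow> even n"
    proof (cases "even n")
      case False
      then have "vtx False (Suc (Suc n)) = Suc (Suc n)" "vtx False (Suc n) = n" by (auto simp: vtx_def)
      then show ?thesis using ln_eq[of "Suc (Suc n)" n] not_dvd_small[of 2] False by (simp add: cell_def)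
    qed (simp add: cell_def vtx_def)
    have "batch_yearn M (Suc (Suc n)) = (let (v, h) = batch_yearn M (Suc n) in
        if even n then (v, forced_hdir (M $$ cell (Suc (Suc n))) v)
        else (forced_vdir (M $$ cell (Suc (Suc n))) h, h))"
      unfolding batch_yearn.simps c Let_def sh ..
    also have "\<dots> = (if wv (vtx False (Suc (Suc n))) then Top else Bottom,
        if wv (vtx True (Suc (Suc n))) then Left else Right)"
      unfolding IH[simplified] using m
      by (cases "even n") (auto simp: vtx_def forced_hdir_def forced_vdir_def simp del: wv.simps)
    finally show ?thesis unfolding Suc .
  qed
qed simp

section \<open>Comparison of \<open>prm n\<close> with \<open>P_seq M n\<close>\<close>

context
  assumes per: "wv L = wv 0"
begin

interpretation line_cycle L ln wv by (rule line_cycle_even[OF per])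

lemma order_eq: "row_order M n = ord False n" "col_order M n = ord True n"
  unfolding row_order_def col_order_def ord_def
  by (rule batch_order_cong; simp add: batch_cell_eq batch_yearn_eq cell_def)+

lemma dim_block: "dim_row (batch_block M n b) = mult n b"
  by (simp add: batch_block_def mult_def mat_of_rows_list_def)

text \<open>\<open>split_lines\<close> labels by position inside a block, \<open>plist\<close> by
  copy number; the two are opposite in lines yearning forward.\<close>

lemma plist_split: "plist e n = map (\<lambda>(i, u). (ord e n ! i,
    if wv (vtx e (ord e n ! i)) then u else mult n (ord e n ! i) - 1 - u)) (split_lines M n (ord e n))"
proof -
  have "map (blk e n) (ord e n) = map (\<lambda>i. blk e n (ord e n ! i)) [0..<length (ord e n)]"
    using map_map[of "blk e n" "(!) (ord e n)" "[0..<length (ord e n)]"] by (simp add: map_nth comp_def)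
  then show ?thesis
    unfolding plist_def split_lines_def dim_block blk_def map_concat by (simp add: comp_def)
qed

text \<open>Exactly one direction reverses the positions if the sign is -1, and none or both if it
  is 1. In copy numbers both blocks thus become the identity.\<close>

lemma block_index:
  assumes "1 \<le> b" "u < mult n b" "v < mult n b"
  shows "batch_block M n b $$ (u, v) =
    (if (if wv (vtx False b) then u else mult n b - 1 - u) = (if wv (vtx True b) then v else mult n b - 1 - v)
     then 1 else 0)"
proof -
  have m: "M $$ batch_cell M b = 1 \<longleftrightarrow> wv (vtx False b) = wv (vtx True b)"
    using entry_wv[OF assms(1)] batch_cell_eq[OF assms(1)] by simp
  show ?thesis
  proof (cases "b = 1 \<or> b = n")
    case True
    then have "u = 0 \<or> u = 1" "v = 0 \<or> v = 1" using assms(2,3) by (auto simp: mult_def)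
    then show ?thesis using True m
      by (elim disjE) (auto simp: batch_block_def mult_def mat_of_rows_list_def)
  next
    case False
    then show ?thesis using assms(2,3) by (auto simp: batch_block_def mult_def)
  qed
qed

text \<open>Both matrices have a 1 where row and column carry the same point.\<close>

lemma perm_matrix_prm: "perm_matrix (prm n) = P_seq M n"
proof -
  let ?R = "split_lines M n (ord False n)" and ?C = "split_lines M n (ord True n)"
  have lenp: "length (plist e n) = length (split_lines M n (ord e n))" for e
    using arg_cong[OF plist_split, of length e n] by simp
  have "length (plist e n) = card (pts n)" for e
    using distinct_card[OF plist_distinct, of e n] by (simp add: set_plist)
  then have len: "length (prm n) = length ?R" "length (prm n) = length ?C"
    using lenp[of False] lenp[of True] by (simp_all add: prm_def perm_of_def)
  have so: "set (ord e n) = {1..n}" "length (ord e n) = n" for e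
  proof -
    show s: "set (ord e n) = {1..n}" using ord_sorted by blast
    have "distinct (ord e n)"
      by (rule sorted_wrt_irrefl_distinct[OF conjunct2[OF ord_sorted]]) (rule pless_irrefl)
    then show "length (ord e n) = n" using distinct_card s by fastforce
  qed
  have mem: "i < n \<and> 1 \<le> ord e n ! i \<and> u < mult n (ord e n ! i)"
    if "x < length (prm n)" "split_lines M n (ord e n) ! x = (i, u)" for e x i u
  proof -
    have "x < length (split_lines M n (ord e n))" using that(1) len by (cases e) auto
    then have "(i, u) \<in> set (split_lines M n (ord e n))" using that(2) nth_mem by metis
    then have "i < n" "u < mult n (ord e n ! i)" by (auto simp: split_lines_def dim_block so)
    moreover have "1 \<le> ord e n ! i" using so nth_mem[of i "ord e n"] \<open>i < n\<close> by auto
    ultimately show ?thesis by simp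
  qed
  show ?thesis
  proof (rule eq_matI)
    show "dim_row (perm_matrix (prm n)) = dim_row (P_seq M n)"
      "dim_col (perm_matrix (prm n)) = dim_col (P_seq M n)"
      using len by (simp_all add: perm_matrix_def P_seq_def Let_def order_eq)
    fix x y assume "x < dim_row (P_seq M n)" "y < dim_col (P_seq M n)"
    then have xy: "x < length (prm n)" "y < length (prm n)"
      using len by (simp_all add: P_seq_def Let_def order_eq)
    obtain i u j v where iu: "?R ! x = (i, u)" and jv: "?C ! y = (j, v)" by fastforce
    let ?b = "ord False n ! i" and ?c = "ord True n ! j"
    let ?u = "if wv (vtx False ?b) then u else mult n ?b - 1 - u"
    let ?v = "if wv (vtx True ?c) then v else mult n ?c - 1 - v"
    have px: "plist False n ! x = (?b, ?u)"
      using xy(1) iu len by (subst plist_split) simp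
    have py: "plist True n ! y = (?c, ?v)"
      using xy(2) jv len by (subst plist_split) simp
    have "prm n ! x = y \<longleftrightarrow> plist False n ! x = plist True n ! y"
    proof -
      have "y < length (plist True n)" using xy len lenp[of True] by simp
      moreover have "plist False n ! x \<in> set (plist True n)" using prm_pts[OF xy(1)] set_plist by simp
      ultimately show ?thesis unfolding prm_nth[OF xy(1)]
        using idx_nth[OF plist_distinct] nth_idx[OF plist_distinct] by metis
    qed
    then have "perm_matrix (prm n) $$ (x, y) = (if ?b = ?c \<and> ?u = ?v then 1 else 0)"
      using xy px py by (simp add: perm_matrix_def)
    moreover have m: "i < n" "j < n" "1 \<le> ?b" "u < mult n ?b" "v < mult n ?c"
      using mem[OF xy(1) iu] mem[OF xy(2) jv] by auto
    have "P_seq M n $$ (x, y) = (if ?b = ?c then batch_block M n ?b $$ (u, v) else 0)"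
      using xy len iu jv m(1,2) by (simp add: P_seq_def Let_def order_eq P_bar_def)
    ultimately show "perm_matrix (prm n) $$ (x, y) = P_seq M n $$ (x, y)"
      using block_index[OF m(3,4), of v] m(5) by auto
  qed
qed

lemma P_seq_antichain:
  "\<exists>N \<pi>. (\<forall>n\<ge>N. is_perm (\<pi> n) \<and> perm_matrix (\<pi> n) = P_seq M n) \<and>
     \<pi> ` {N..} \<subseteq> profile_class M \<and> infinite (\<pi> ` {N..}) \<and> antichain (\<pi> ` {N..})"
proof -
  let ?N = "(3 * L ^ L + 10) * L"
  have 1: "\<forall>n\<ge>?N. is_perm (prm n) \<and> perm_matrix (prm n) = P_seq M n"
    by (intro allI impI conjI is_perm_prm perm_matrix_prm)
  have 2: "prm ` {?N..} \<subseteq> profile_class M"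
    by (rule image_subsetI) (rule profile_even[OF per])
  show ?thesis by (intro exI[of _ ?N] exI[of _ prm] conjI 1 2 prm_antichain)
qed

end

text \<open>The batches \<open>1, ..., L\<close> visit each nonzero cell once, so the sign changes
  along a round count the entries -1.\<close>

lemma wv_L_iff: "wv L = wv 0 \<longleftrightarrow> even (card {(i, j). i < dim_row M \<and> j < dim_col M \<and> M $$ (i, j) = -1})"
proof -
  have inj: "inj_on cell {1..L}"
  proof (rule inj_onI)
    fix b c assume "b \<in> {1..L}" "c \<in> {1..L}" "cell b = cell c"
    then show "b = c" using cell_eq[of b c] dvd_abs_less_imp_0[of "int L" "int b - int c"] by auto
  qed
  have "cell ` {b \<in> {1..L}. M $$ cell b = -1}
      = {(i, j). i < dim_row M \<and> j < dim_col M \<and> M $$ (i, j) = -1}" (is "?A = ?B")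
  proof
    have "cell b \<in> supp M" if "1 \<le> b" for b using supp_eq that by simp
    then show "?A \<subseteq> ?B" by (force simp: supp_def)
    show "?B \<subseteq> ?A"
    proof
      fix x assume x: "x \<in> ?B"
      then have "x \<in> supp M" by (auto simp: supp_def)
      then obtain c where c: "x = cell c" "1 \<le> c" using supp_eq by auto
      \<comment> \<open>The representative of \<open>c\<close> modulo \<open>L\<close> among
        \<open>1, ..., L\<close>.\<close>
      define b where "b = (c - 1) mod L + 1"
      have b: "b \<in> {1..L}" using L_ge by (simp add: b_def Suc_le_eq)
      have "int c - int b = int (c - 1) - int (c - 1) mod int L"
        using c(2) by (simp add: b_def of_nat_mod of_nat_diff)
      then have "int L dvd int c - int b" by (metis dvd_minus_mod)
      then have "x = cell b" using cell_eq[of c b] c b by simp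
      then show "x \<in> ?A" using b x by auto
    qed
  qed
  moreover have "card ?A = card {b \<in> {1..L}. M $$ cell b = -1}"
    by (rule card_image) (rule inj_on_subset[OF inj], auto)
  ultimately show ?thesis using wv_odd[of L] by simp
qed

end

section \<open>From a cycle in the graph to both claims\<close>

lemma cycle_graph_incident:
  assumes "cycle_graph V E"
  shows "V \<noteq> {}" and "v \<in> V \<Longrightarrow> \<exists>v'. {v, v'} \<in> E"
proof -
  obtain vs where vs: "3 \<le> length vs" "V = set vs"
    "E = {{vs ! i, vs ! (Suc i mod length vs)} | i. i < length vs}"
    using assms unfolding cycle_graph_def by blast
  show "V \<noteq> {}" using vs(1,2) by auto
  assume "v \<in> V"
  then obtain i where "i < length vs" "v = vs ! i" using vs(2) by (auto simp: in_set_conv_nth)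
  then show "\<exists>v'. {v, v'} \<in> E" using vs(3) by blast
qed

lemma graph_edgesD: "x \<in> graph_edges M \<Longrightarrow> \<exists>i j. (i, j) \<in> supp M \<and> x = {Inr j, Inl i}"
  by (auto simp: graph_edges_def)

theorem theorem4p3:
  fixes M :: "int mat"
  assumes "elements_mat M \<subseteq> {0, 1, -1}"
  shows "(contains_cycle (graph_verts M) (graph_edges M) \<longrightarrow>
            (\<exists>A \<subseteq> profile_class M. infinite A \<and> antichain A)) \<and>
         (cycle_graph (graph_verts M) (graph_edges M) \<and>
          even (card {(i, j). i < dim_row M \<and> j < dim_col M \<and> M $$ (i, j) = -1}) \<longrightarrow>
            (\<exists>N. \<exists>\<pi> :: nat \<Rightarrow> nat list.
               (\<forall>n\<ge>N. is_perm (\<pi> n) \<and> perm_matrix (\<pi> n) = P_seq M n) \<and>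
               \<pi> ` {N..} \<subseteq> profile_class M \<and>
               infinite (\<pi> ` {N..}) \<and>
               antichain (\<pi> ` {N..})))"
proof (intro conjI impI)
  assume "contains_cycle (graph_verts M) (graph_edges M)"
  then obtain V E where VE: "E \<subseteq> graph_edges M" "cycle_graph V E" unfolding contains_cycle_def by blast
  obtain v where "v \<in> V" using cycle_graph_incident(1)[OF VE(2)] by (metis all_not_in_conv)
  then obtain v' where v': "{v, v'} \<in> E" using cycle_graph_incident(2)[OF VE(2)] by (metis (no_types))
  obtain i j where "{v, v'} = {Inr j, Inl i}" using graph_edgesD[OF subsetD[OF VE(1) v']] by (elim exE conjE)
  with v' have "{Inr j, Inl i} \<in> E" by simp
  from matrix_cycle_of_graph[OF assms VE(2,1) this] obtain L ln where "matrix_cycle M L ln"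
    by (elim exE conjE)
  then show "\<exists>A \<subseteq> profile_class M. infinite A \<and> antichain A"
    by (rule matrix_cycle.ex_infinite_antichain)
next
  assume c: "cycle_graph (graph_verts M) (graph_edges M) \<and>
    even (card {(i, j). i < dim_row M \<and> j < dim_col M \<and> M $$ (i, j) = -1})"
  note inc = cycle_graph_incident[OF conjunct1[OF c]]
  \<comment> \<open>A cycle has an edge, so \<open>M\<close> has a row 0, whose vertex lies on the
    cycle; its leftmost nonzero entry is the edge with which the numbering starts.\<close>
  obtain u where "u \<in> graph_verts M" using inc(1) by (metis all_not_in_conv)
  then have "\<exists>v. {u, v} \<in> graph_edges M" by (rule inc(2))
  then have "graph_edges M \<noteq> {}" by (elim exE) (metis empty_iff)
  then have "supp M \<noteq> {}" by (simp add: graph_edges_def)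
  then have "0 < dim_row M" by (auto simp: supp_def)
  then have "Inl 0 \<in> graph_verts M" by (simp add: graph_verts_def)
  from inc(2)[OF this] obtain v where "{Inl 0, v} \<in> graph_edges M" ..
  then have "\<exists>j. (0, j) \<in> supp M" by (auto simp: graph_edges_def doubleton_eq_iff)
  then have "(0, LEAST j. (0, j) \<in> supp M) \<in> supp M" by (rule LeastI_ex)
  then have e: "{Inr (LEAST j. (0, j) \<in> supp M), Inl 0} \<in> graph_edges M"
    by (force simp: graph_edges_def)
  obtain L ln where mc: "matrix_cycle M L ln" and ln: "ln 0 = (LEAST j. (0, j) \<in> supp M)" "ln 1 = 0"
    and ge: "graph_edges M = {{Inl (ln (vtx False b)), Inr (ln (vtx True b))} | b. 1 \<le> b}"
    using matrix_cycle_of_graph[OF assms conjunct1[OF c] order_refl e] by (elim exE conjE)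
  interpret matrix_cycle M L ln by (rule mc)
  have "x \<in> supp M \<longleftrightarrow> {Inl (fst x), Inr (snd x)} \<in> graph_edges M" for x
    by (force simp: graph_edges_def doubleton_eq_iff)
  then have "supp M = cell ` {1..}"
    unfolding ge by (auto simp: cell_def doubleton_eq_iff image_iff prod_eq_iff)
  then interpret full_matrix_cycle M L ln by unfold_locales (use ln in auto)
  show "\<exists>N. \<exists>\<pi> :: nat \<Rightarrow> nat list.
      (\<forall>n\<ge>N. is_perm (\<pi> n) \<and> perm_matrix (\<pi> n) = P_seq M n) \<and>
      \<pi> ` {N..} \<subseteq> profile_class M \<and> infinite (\<pi> ` {N..}) \<and> antichain (\<pi> ` {N..})"
    using P_seq_antichain wv_L_iff c by blast
qed

end
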